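(* Let $T:X\to X$, $X=[0,1]^2$, be the baker's transformation with parameter $\gamma\in(0,1/2)$ defined in the context, and let $\mu$ be its SRB measure. Then for $\mu$-almost every $z\in X$ the following holds. Put $\Xi(x)=-\log d(x,z)$, where $d$ is the Euclidean metric, and $M_n(x):=\max\{\Xi(x),\Xi(Tx),\dots,\Xi(T^{n-1}x)\}$. If $z$ is not a periodic point of $T$, and if $\tau>0$ and the sequence of real numbers $(u_n)$ satisfy $n\,\mu(B(z,e^{-u_n}))\to\tau$ as $n\to\infty$, then $$\lim_{n\to\infty}\mu(M_n\le u_n)=e^{-\tau}.$$
   Context: The baker's transformation: fix $\alpha=1/2$ and $\gamma\in(0,1/2)$ (so $\gamma_a=\gamma_b=\gamma$). On $X=[0,1]^2$ put $T(x,y)=(\gamma x,\,2y)$ if $y<1/2$ and $T(x,y)=((1-\gamma)+\gamma x,\,2y-1)$ if $y\ge 1/2$ (the value on the $\mu$-null line $y=1/2$ is a convention). Unstable leaves are the vertical segments $\{x\}\times[0,1]$. The SRB measure $\mu$ is the unique $T$-invariant Borel probability measure on $X$ whose conditional measures on the vertical unstable leaves are normalized Lebesgue (arclength) measure. $B(z,r)=\{x\in X: d(x,z)<r\}$ is the Euclidean ball. Convention: $-\log 0=+\infty$. *)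

theory Defs
  imports "HOL-Probability.Probability"
begin

text \<open>Points of the plane have type \<^typ>\<open>real \<times> real\<close>, on which \<^const>\<open>dist\<close> is the
  Euclidean distance.\<close>

definition unit_square :: "(real \<times> real) set" where
  "unit_square = {0..1} \<times> {0..1}"

definition baker :: "real \<Rightarrow> real \<times> real \<Rightarrow> real \<times> real" where
  "baker \<gamma> = (\<lambda>(x, y). if y < 1 / 2 then (\<gamma> * x, 2 * y)
                      else ((1 - \<gamma>) + \<gamma> * x, 2 * y - 1))"

text \<open>Normalized arclength on the vertical unstable leaf \<open>{x} \<times> [0, 1]\<close>, as a Borel measure
  on the plane.\<close>

definition leaf_measure :: "real \<Rightarrow> (real \<times> real) measure" where
  "leaf_measure x = distr (uniform_measure lborel {0..1}) borel (\<lambda>y. (x, y))"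

text \<open>The last conjunct says that \<open>leaf_measure x\<close> is the system of conditional measures of
  \<open>\<mu>\<close> on the partition into vertical leaves: \<open>leaf_measure (fst p)\<close> is concentrated on the leaf
  through \<open>p\<close>, depends only on that leaf, and averages to \<open>\<mu>\<close>.\<close>

definition is_SRB_measure :: "real \<Rightarrow> (real \<times> real) measure \<Rightarrow> bool" where
  "is_SRB_measure \<gamma> \<mu> \<longleftrightarrow>
     prob_space \<mu> \<and>
     sets \<mu> = sets (restrict_space borel unit_square) \<and>
     distr \<mu> \<mu> (baker \<gamma>) = \<mu> \<and>
     (\<forall>A\<in>sets \<mu>. emeasure \<mu> A = (\<integral>\<^sup>+ p. emeasure (leaf_measure (fst p)) A \<partial>\<mu>))"

definition periodic_point :: "('a \<Rightarrow> 'a) \<Rightarrow> 'a \<Rightarrow> bool" where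
  "periodic_point T z \<longleftrightarrow> (\<exists>p>0. (T ^^ p) z = z)"

definition square_ball :: "real \<times> real \<Rightarrow> real \<Rightarrow> (real \<times> real) set" where
  "square_ball z r = {x \<in> unit_square. dist x z < r}"

text \<open>The convention \<open>-log 0 = \<infinity>\<close> has to be imposed by hand, since \<^term>\<open>ln (0 :: real)\<close> is
  \<open>0\<close> in the library.\<close>

definition log_dist_obs :: "'a::metric_space \<Rightarrow> 'a \<Rightarrow> ereal" where
  "log_dist_obs z x = (if x = z then \<infinity> else ereal (- ln (dist x z)))"

text \<open>Meaningful for \<open>n \<ge> 1\<close> only; the value at \<open>n = 0\<close> does not affect limits in \<open>n\<close>.\<close>

definition max_process :: "('a \<Rightarrow> 'a) \<Rightarrow> ('a \<Rightarrow> ereal) \<Rightarrow> nat \<Rightarrow> 'a \<Rightarrow> ereal" where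
  "max_process T \<Xi> n x = Max ((\<lambda>i. \<Xi> ((T ^^ i) x)) ` {..<n})"

end

theory Submission
  imports Defs "HOL-Real_Asymp.Real_Asymp"
begin

text \<open>Let \<open>B\<close> be the ball of radius \<open>exp (- u\<^sub>n)\<close> about \<open>z\<close>, so that \<open>M\<^sub>n \<le> u\<^sub>n\<close> means that the
  orbit avoids \<open>B\<close> up to time \<open>n\<close>. Splitting off the first step of the orbit shows that the probability \<open>w\<^sub>N\<close>
  of avoiding \<open>B\<close> up to time \<open>N\<close> satisfies \<open>w\<^sub>N\<^sub>+\<^sub>1 = (1 - \<mu> B) w\<^sub>N\<close> up to a mixing error, the
  probability of a return to \<open>B\<close> within a gap \<open>g\<close>, and \<open>g (\<mu> B)\<^sup>2\<close>. It remains to see that these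
  errors are \<open>o(1/n)\<close> when \<open>g\<close> is of order \<open>log\<^sup>2 n\<close>.

  Mixing: up to \<open>2\<^sup>-\<^sup>m\<close>, the point \<open>p\<close> depends only on its abscissa and on \<open>m\<close> binary digits of its
  ordinate, while its orbit after time \<open>2m\<close> depends only on the remaining digits. On each
  vertical leaf the two are exactly independent, and thin annuli have small measure.

  Short returns: the set of points with \<open>d(p, T\<^sup>j p) < \<epsilon>\<close> has measure at most \<open>4 \<epsilon>\<close>,
  already along each leaf. Covering the square by a grid of mesh comparable to \<open>\<epsilon>\<close> and using
  Borel-Cantelli, for almost every \<open>z\<close> these points fill only a small proportion of the small
  balls about \<open>z\<close>.\<close>

section \<open>Avoidance probabilities of a measure-preserving map\<close>

definition avoiding :: "'a measure \<Rightarrow> ('a \<Rightarrow> 'a) \<Rightarrow> 'a set \<Rightarrow> nat \<Rightarrow> 'a set" where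
  "avoiding M T A N = {x \<in> space M. \<forall>j<N. (T ^^ j) x \<notin> A}"

context prob_space
begin

lemma prob_funpow_vimage:
  assumes T[measurable]: "T \<in> measurable M M" and "distr M M T = M" and A[measurable]: "A \<in> sets M"
  shows "prob {x \<in> space M. (T ^^ j) x \<in> A} = prob A"
proof (induction j)
  case 0
  have "{x \<in> space M. x \<in> A} = A" using sets.sets_into_space[OF A] by auto
  then show ?case by simp
next
  case (Suc j)
  let ?B = "{x \<in> space M. (T ^^ j) x \<in> A}"
  have B: "?B \<in> sets M" by measurable
  have "prob ?B = measure (distr M M T) ?B" using assms(2) by simp
  also have "\<dots> = prob (T -` ?B \<inter> space M)"
    by (rule measure_distr[OF T B])
  also have "T -` ?B \<inter> space M = {x \<in> space M. (T ^^ Suc j) x \<in> A}"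
    using measurable_space[OF T] by (auto simp: funpow_swap1)
  finally show ?case using Suc by simp
qed

lemma sets_avoiding:
  assumes [measurable]: "T \<in> measurable M M" "A \<in> sets M"
  shows "avoiding M T A N \<in> sets M"
  unfolding avoiding_def by measurable

lemma prob_diff_le_sum:
  assumes "U \<in> sets M" "V \<in> sets M" "finite J" "\<And>j. j \<in> J \<Longrightarrow> D j \<in> sets M"
    and "V - U \<subseteq> (\<Union>j\<in>J. D j)"
  shows "prob V \<le> prob U + (\<Sum>j\<in>J. prob (D j))"
proof -
  have "prob V \<le> prob (U \<union> (\<Union>j\<in>J. D j))"
    using assms by (intro finite_measure_mono) auto
  also have "\<dots> \<le> prob U + prob (\<Union>j\<in>J. D j)"
    using assms by (intro measure_Un_le) auto
  also have "prob (\<Union>j\<in>J. D j) \<le> (\<Sum>j\<in>J. prob (D j))"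
    using assms by (intro finite_measure_subadditive_finite) auto
  finally show ?thesis by simp
qed

text \<open>Invariance turns the splitting at the first step into
  \<open>prob (?W (Suc N)) = prob (?W N) - prob (A \<inter> ?L)\<close>. In \<open>?L\<close> the
  constraint at the times \<open>1..<g\<close> is dropped at the cost of the early returns, mixing
  decouples what remains from \<open>A\<close>, and replacing the window \<open>Suc N - g\<close> by
  \<open>N\<close> costs at most \<open>g * prob A\<close>, which is multiplied by
  \<open>prob A\<close>.\<close>

lemma avoiding_step:
  fixes A g N \<eta>
  assumes T[measurable]: "T \<in> measurable M M" and inv: "distr M M T = M"
    and A[measurable]: "A \<in> sets M" and g: "1 \<le> g"
    and mix: "\<bar>prob (A \<inter> {x \<in> space M. (T ^^ g) x \<in> avoiding M T A (Suc N - g)})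
                - prob A * prob (avoiding M T A (Suc N - g))\<bar> \<le> \<eta>"
  shows "\<bar>prob (avoiding M T A (Suc N)) - (1 - prob A) * prob (avoiding M T A N)\<bar>
    \<le> \<eta> + (\<Sum>j=1..<g. prob (A \<inter> {x \<in> space M. (T ^^ j) x \<in> A})) + real g * (prob A)\<^sup>2"
proof -
  note sets_avoiding[OF T A, measurable]
  let ?W = "avoiding M T A" and ?p = "prob A"
  \<comment> \<open>There are \<open>Suc N - g\<close> times in \<open>{g..N}\<close>. For
    \<open>g > N\<close> the truncated difference is 0 and \<open>?R\<close> is the whole space, in
    agreement with an empty \<open>{g..N}\<close>.\<close>
  let ?N = "Suc N - g"
  let ?S = "\<Sum>j=1..<g. prob (A \<inter> {x \<in> space M. (T ^^ j) x \<in> A})"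
  let ?L = "{x \<in> space M. (T ^^ 1) x \<in> ?W N}"
  let ?R = "{x \<in> space M. (T ^^ g) x \<in> ?W ?N}"
  have Tj: "(T ^^ j) x \<in> space M" if "x \<in> space M" for x j
    using that measurable_space[OF measurable_compose_n[OF T]] by blast
  have add: "(T ^^ i) ((T ^^ j) x) = (T ^^ (i + j)) x" for i j x
    by (simp add: funpow_add)
  have L: "?L = {x \<in> space M. \<forall>j\<in>{1..N}. (T ^^ j) x \<notin> A}"
  proof -
    have "(\<forall>j<N. (T ^^ (j + 1)) x \<notin> A) \<longleftrightarrow> (\<forall>j\<in>{1..N}. (T ^^ j) x \<notin> A)" for x
    proof -
      have "\<exists>i<N. i + 1 = j" if "j \<in> {1..N}" for j using that by (intro exI[of _ "j - 1"]) auto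
      then show ?thesis by (metis Suc_eq_plus1 Suc_leI atLeastAtMost_iff le_add2)
    qed
    moreover have "(T ^^ 1) x \<in> ?W N \<longleftrightarrow> (\<forall>j<N. (T ^^ (j + 1)) x \<notin> A)" if "x \<in> space M" for x
      using that Tj[of x 1] unfolding avoiding_def by (simp only: add mem_Collect_eq) blast
    ultimately show ?thesis by blast
  qed
  have R: "?R = {x \<in> space M. \<forall>j\<in>{g..N}. (T ^^ j) x \<notin> A}"
  proof -
    have "(\<forall>j<?N. (T ^^ (j + g)) x \<notin> A) \<longleftrightarrow> (\<forall>j\<in>{g..N}. (T ^^ j) x \<notin> A)" for x
    proof -
      have "\<exists>i<?N. i + g = j" if "j \<in> {g..N}" for j using that by (intro exI[of _ "j - g"]) auto
      moreover have "j + g \<in> {g..N}" if "j < ?N" for j using that by auto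
      ultimately show ?thesis by metis
    qed
    moreover have "(T ^^ g) x \<in> ?W ?N \<longleftrightarrow> (\<forall>j<?N. (T ^^ (j + g)) x \<notin> A)" if "x \<in> space M" for x
      using that Tj[of x g] unfolding avoiding_def by (simp only: add mem_Collect_eq) blast
    ultimately show ?thesis by blast
  qed
  have Lm: "?L \<in> sets M" and Rm: "?R \<in> sets M" by measurable
  have "prob (A \<inter> ?L) \<le> prob (A \<inter> ?R)"
    using Lm Rm A g unfolding L R by (intro finite_measure_mono) auto
  moreover have "prob (A \<inter> ?R) \<le> prob (A \<inter> ?L) + ?S"
    using Lm Rm A g unfolding L R by (intro prob_diff_le_sum) auto
  moreover have "prob (?W (Suc N)) = prob (?W N) - prob (A \<inter> ?L)"
  proof -
    have "(\<forall>j<Suc N. (T ^^ j) x \<notin> A) \<longleftrightarrow> x \<notin> A \<and> (\<forall>j\<in>{1..N}. (T ^^ j) x \<notin> A)" for x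
      by (metis Suc_leI atLeastAtMost_iff funpow_0 gr0I less_Suc_eq_le One_nat_def zero_less_Suc)
    then have "?W (Suc N) = ?L - A"
      unfolding L by (auto simp: avoiding_def)
    then have "prob (?W (Suc N)) = prob ?L - prob (?L \<inter> A)"
      using finite_measure_Diff'[OF Lm A] by simp
    also have "prob ?L = prob (?W N)"
      by (rule prob_funpow_vimage[OF T inv]) measurable
    finally show ?thesis by (simp add: Int_commute)
  qed
  moreover have "prob (?W N) \<le> prob (?W ?N)"
    using g by (intro finite_measure_mono) (auto simp: avoiding_def)
  moreover have "prob (?W ?N) \<le> prob (?W N) + g * ?p"
  proof -
    have "prob (?W ?N) \<le> prob (?W N) + (\<Sum>j\<in>{?N..<N}. prob {x \<in> space M. (T ^^ j) x \<in> A})"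
    proof (rule prob_diff_le_sum)
      show "?W ?N - ?W N \<subseteq> (\<Union>j\<in>{?N..<N}. {x \<in> space M. (T ^^ j) x \<in> A})"
        by (auto simp: avoiding_def) (meson atLeastLessThan_iff not_less)
    qed auto
    also have "(\<Sum>j\<in>{?N..<N}. prob {x \<in> space M. (T ^^ j) x \<in> A}) = (N - ?N) * ?p"
      by (simp add: prob_funpow_vimage[OF T inv A])
    also have "\<dots> \<le> g * ?p"
      by (intro mult_right_mono) auto
    finally show ?thesis by simp
  qed
  ultimately have 1: "prob (?W (Suc N)) = prob (?W N) - prob (A \<inter> ?L)"
    "\<bar>prob (A \<inter> ?L) - prob (A \<inter> ?R)\<bar> \<le> ?S" "\<bar>prob (?W ?N) - prob (?W N)\<bar> \<le> g * ?p"
    by auto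
  have "\<bar>?p * prob (?W ?N) - ?p * prob (?W N)\<bar> \<le> g * ?p\<^sup>2"
    using mult_left_mono[OF 1(3), of ?p]
    by (simp add: abs_mult right_diff_distrib[symmetric] power2_eq_square ac_simps)
  then show ?thesis using 1(1,2) mix by (simp add: left_diff_distrib)
qed

text \<open>The one-step errors merely add up: the factor \<open>1 - prob A\<close> is at most 1, so
  the error accumulated so far is not amplified.\<close>

lemma avoiding_approx:
  fixes A g \<eta>
  assumes T: "T \<in> measurable M M" and inv: "distr M M T = M"
    and A: "A \<in> sets M" and g: "1 \<le> g"
    and mix: "\<And>N. N \<le> n \<Longrightarrow> \<bar>prob (A \<inter> {x \<in> space M. (T ^^ g) x \<in> avoiding M T A N})
                - prob A * prob (avoiding M T A N)\<bar> \<le> \<eta>"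
  shows "\<bar>prob (avoiding M T A n) - (1 - prob A) ^ n\<bar>
    \<le> real n * (\<eta> + (\<Sum>j=1..<g. prob (A \<inter> {x \<in> space M. (T ^^ j) x \<in> A})) + real g * (prob A)\<^sup>2)"
    (is "_ \<le> _ * ?e")
proof -
  let ?W = "avoiding M T A" and ?q = "1 - prob A"
  have "\<bar>prob (?W N) - ?q ^ N\<bar> \<le> real N * ?e" if "N \<le> n" for N
    using that
  proof (induction N)
    case 0
    have "?W 0 = space M" by (simp add: avoiding_def)
    then show ?case by (simp add: prob_space)
  next
    case (Suc N)
    have "\<bar>prob (?W (Suc N)) - ?q * prob (?W N)\<bar> \<le> ?e"
      using Suc.prems g by (intro avoiding_step[OF T inv A g] mix) auto
    moreover have "\<bar>?q * prob (?W N) - ?q * ?q ^ N\<bar> \<le> real N * ?e"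
    proof -
      have "\<bar>?q * prob (?W N) - ?q * ?q ^ N\<bar> = ?q * \<bar>prob (?W N) - ?q ^ N\<bar>"
        by (simp add: abs_mult flip: right_diff_distrib)
      also have "\<dots> \<le> 1 * \<bar>prob (?W N) - ?q ^ N\<bar>"
        by (intro mult_right_mono) auto
      finally show ?thesis using Suc by simp
    qed
    ultimately show ?case by (simp add: algebra_simps)
  qed
  then show ?thesis by simp
qed

text \<open>Passing from \<open>A \<inter> F\<close> to \<open>A' \<inter> F'\<close> changes the
  probability by at most \<open>a + b\<close>, and so does passing from
  \<open>prob A * prob F\<close> to \<open>prob A' * prob F'\<close>; hence the factor 2.\<close>

lemma near_independent:
  assumes "A \<in> sets M" "A' \<in> sets M" "F \<in> sets M" "F' \<in> sets M"
    and indep: "prob (A' \<inter> F') = prob A' * prob F'"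
    and D: "D \<in> sets M" "(A - A') \<union> (A' - A) \<subseteq> D" "prob D \<le> a"
    and D': "D' \<in> sets M" "(F - F') \<union> (F' - F) \<subseteq> D'" "prob D' \<le> b"
  shows "\<bar>prob (A \<inter> F) - prob A * prob F\<bar> \<le> 2 * (a + b)"
proof -
  have close: "\<bar>prob X - prob Y\<bar> \<le> prob Z"
    if "X \<in> sets M" "Y \<in> sets M" "Z \<in> sets M" "X - Y \<union> (Y - X) \<subseteq> Z" for X Y Z
  proof -
    have "prob X \<le> prob (Y \<union> Z)" "prob Y \<le> prob (X \<union> Z)"
      using that by (auto intro!: finite_measure_mono)
    moreover have "prob (Y \<union> Z) \<le> prob Y + prob Z" "prob (X \<union> Z) \<le> prob X + prob Z"
      using that by (auto intro!: measure_Un_le)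
    ultimately show ?thesis by simp
  qed
  have 1: "\<bar>prob A - prob A'\<bar> \<le> a" using close[of A A' D] assms by simp
  have 2: "\<bar>prob F - prob F'\<bar> \<le> b" using close[of F F' D'] assms by simp
  have "\<bar>prob (A \<inter> F) - prob (A' \<inter> F')\<bar> \<le> prob (D \<union> D')"
    using assms by (intro close) auto
  also have "\<dots> \<le> a + b"
    using measure_Un_le[of D M D'] assms by simp
  finally have 3: "\<bar>prob (A \<inter> F) - prob A' * prob F'\<bar> \<le> a + b" using indep by simp
  have "\<bar>prob A * (prob F - prob F')\<bar> \<le> 1 * b"
    unfolding abs_mult using 2 by (intro mult_mono) auto
  moreover have "\<bar>(prob A - prob A') * prob F'\<bar> \<le> a * 1"
    unfolding abs_mult using 1 by (intro mult_mono) auto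
  ultimately show ?thesis using 3 by (simp add: algebra_simps)
qed

end

section \<open>Lebesgue measure: binary digits, near-fixed points, square windows\<close>

lemma lborel_dyadic_piece:
  fixes G :: "real set"
  assumes [measurable]: "G \<in> sets borel"
  shows "emeasure lborel {y. \<lfloor>2 ^ m * y\<rfloor> = i \<and> frac (2 ^ m * y) \<in> G}
       = ennreal (1 / 2 ^ m) * emeasure lborel (G \<inter> {0..<1})"
proof -
  let ?A = "{y. \<lfloor>2 ^ m * y\<rfloor> = i \<and> frac (2 ^ m * y) \<in> G} :: real set"
  have eq: "?A = {y. real_of_int i \<le> 2 ^ m * y \<and> 2 ^ m * y < real_of_int i + 1 \<and> 2 ^ m * y - real_of_int i \<in> G}"
    by (auto simp: frac_def floor_eq_iff[THEN iffD2])
  have [measurable]: "?A \<in> sets borel" unfolding eq by measurable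
  have "emeasure lborel ?A = (\<integral>\<^sup>+y. indicator ?A y \<partial>lborel)" by simp
  \<comment> \<open>The substitution carries \<open>{0..<1}\<close> onto the dyadic interval of
    index \<open>i\<close>, and the new variable is \<open>frac (2 ^ m * y)\<close> there.\<close>
  also have "\<dots> = ennreal \<bar>1 / 2 ^ m\<bar> * (\<integral>\<^sup>+y. indicator ?A (real_of_int i / 2 ^ m + 1 / 2 ^ m * y) \<partial>lborel)"
    by (rule nn_integral_real_affine) auto
  also have "(\<lambda>y. indicator ?A (real_of_int i / 2 ^ m + 1 / 2 ^ m * y)) = (indicator (G \<inter> {0..<1}) :: real \<Rightarrow> ennreal)"
  proof
    fix y :: real
    have "real_of_int i / 2 ^ m + 1 / 2 ^ m * y \<in> ?A \<longleftrightarrow> y \<in> G \<inter> {0..<1}"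
      unfolding eq by (auto simp: distrib_left)
    then show "indicator ?A (real_of_int i / 2 ^ m + 1 / 2 ^ m * y) = (indicator (G \<inter> {0..<1}) y :: ennreal)"
      unfolding indicator_def by simp
  qed
  finally show ?thesis by simp
qed

text \<open>Every dyadic interval selected by \<open>P\<close> contributes the same amount, so
  \<open>P\<close> enters only through the number \<open>card I\<close> of these intervals.\<close>

lemma lborel_dyadic_independent:
  fixes G :: "real set"
  assumes [measurable]: "G \<in> sets borel"
  shows "emeasure lborel {y \<in> {0..<1}. P \<lfloor>2 ^ m * y\<rfloor> \<and> frac (2 ^ m * y) \<in> G}
       = emeasure lborel {y \<in> {0..<1::real}. P \<lfloor>2 ^ m * y\<rfloor>} * emeasure lborel (G \<inter> {0..<1})"
proof -
  define I where "I = ({i \<in> {0..<2 ^ m}. P i} :: int set)"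
  have fin: "finite I" unfolding I_def by (rule finite_subset[of _ "{0..<2 ^ m}"]) auto
  have split: "emeasure lborel {y \<in> {0..<1}. P \<lfloor>2 ^ m * y\<rfloor> \<and> frac (2 ^ m * y) \<in> H}
     = of_nat (card I) * ennreal (1 / 2 ^ m) * emeasure lborel (H \<inter> {0..<1})"
    if [measurable]: "H \<in> sets borel" for H :: "real set"
  proof -
    have range: "y \<in> {0..<1} \<longleftrightarrow> \<lfloor>2 ^ m * y\<rfloor> \<in> {0..<2 ^ m}" for y :: real
      using mult_le_cancel_left_pos[of "2 ^ m" 0 y] by (auto simp: floor_less_iff)
    have "{y \<in> {0..<1}. P \<lfloor>2 ^ m * y\<rfloor> \<and> frac (2 ^ m * y) \<in> H}
       = (\<Union>i\<in>I. {y. \<lfloor>2 ^ m * y\<rfloor> = i \<and> frac (2 ^ m * y) \<in> H})"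
      unfolding I_def range by auto
    also have "emeasure lborel \<dots> = (\<Sum>i\<in>I. emeasure lborel {y. \<lfloor>2 ^ m * y\<rfloor> = i \<and> frac (2 ^ m * y) \<in> H})"
    proof (rule sum_emeasure[symmetric])
      show "(\<lambda>i. {y. \<lfloor>2 ^ m * y\<rfloor> = i \<and> frac (2 ^ m * y) \<in> H}) ` I \<subseteq> sets lborel"
        unfolding frac_def by auto
    qed (auto simp: disjoint_family_on_def fin)
    also have "\<dots> = (\<Sum>i\<in>I. ennreal (1 / 2 ^ m) * emeasure lborel (H \<inter> {0..<1}))"
      by (intro sum.cong refl lborel_dyadic_piece) auto
    finally show ?thesis by (simp add: mult.assoc)
  qed
  \<comment> \<open>The instance \<open>UNIV\<close> identifies the factor
    \<open>card I / 2 ^ m\<close> as the measure of the digit event.\<close>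
  show ?thesis using split[of G] split[of UNIV] assms by simp
qed

text \<open>On the dyadic interval of index \<open>i\<close> the function
  \<open>frac (2 ^ j * y) - y\<close> is affine with slope \<open>2 ^ j - 1\<close>, which confines
  \<open>y\<close> to an interval of length \<open>2 * \<epsilon> / (2 ^ j - 1)\<close>. There are
  \<open>2 ^ j\<close> such intervals, and \<open>2 ^ j / (2 ^ j - 1)\<close> is at most 2 because
  \<open>j \<ge> 1\<close>.\<close>

lemma lborel_near_fixed_frac:
  fixes \<epsilon> :: real
  assumes "0 \<le> \<epsilon>" "1 \<le> j"
  shows "emeasure lborel {y \<in> {0..<1}. \<bar>frac (2 ^ j * y) - y\<bar> < \<epsilon>} \<le> ennreal (4 * \<epsilon>)"
proof -
  let ?c = "2 ^ j - 1 :: real"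
  have c: "?c \<ge> 2 ^ j / 2" "?c > 0"
    using power_increasing[OF assms(2), of "2::real"] by auto
  have "{y \<in> {0..<1}. \<bar>frac (2 ^ j * y) - y\<bar> < \<epsilon>}
     \<subseteq> (\<Union>i\<in>{0..<2 ^ j}. {(real_of_int i - \<epsilon>) / ?c .. (real_of_int i + \<epsilon>) / ?c})"
  proof (intro subsetI, elim CollectE conjE)
    fix y assume y: "y \<in> {0..<1::real}" "\<bar>frac (2 ^ j * y) - y\<bar> < \<epsilon>"
    then have "\<lfloor>2 ^ j * y\<rfloor> \<in> {0..<2 ^ j}"
      by (auto simp: floor_less_iff zero_le_mult_iff)
    moreover have "\<bar>?c * y - real_of_int \<lfloor>2 ^ j * y\<rfloor>\<bar> < \<epsilon>"
      using y(2) by (simp add: frac_def algebra_simps)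
    then have "y \<in> {(real_of_int \<lfloor>2 ^ j * y\<rfloor> - \<epsilon>) / ?c .. (real_of_int \<lfloor>2 ^ j * y\<rfloor> + \<epsilon>) / ?c}"
      using c(2) by (auto simp: field_simps)
    ultimately show "y \<in> (\<Union>i\<in>{0..<2 ^ j}. {(real_of_int i - \<epsilon>) / ?c .. (real_of_int i + \<epsilon>) / ?c})"
      by blast
  qed
  then have "emeasure lborel {y \<in> {0..<1}. \<bar>frac (2 ^ j * y) - y\<bar> < \<epsilon>}
     \<le> emeasure lborel (\<Union>i\<in>{0..<2 ^ j}. {(real_of_int i - \<epsilon>) / ?c .. (real_of_int i + \<epsilon>) / ?c})"
    by (intro emeasure_mono) auto
  also have "\<dots> \<le> (\<Sum>i\<in>{0..<2 ^ j}. emeasure lborel {(real_of_int i - \<epsilon>) / ?c .. (real_of_int i + \<epsilon>) / ?c})"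
    by (intro emeasure_subadditive_finite) auto
  also have "\<dots> = (\<Sum>i\<in>{0..<2 ^ j :: int}. ennreal (2 * \<epsilon> / ?c))"
    using c assms by (intro sum.cong refl) (simp add: divide_right_mono diff_divide_distrib[symmetric])
  also have "\<dots> = ennreal (2 ^ j * (2 * \<epsilon> / ?c))"
    using c assms by (simp add: ennreal_of_nat_eq_real_of_nat nat_power_eq flip: ennreal_mult')
  also have "\<dots> \<le> ennreal (4 * \<epsilon>)"
    using c assms mult_left_mono[OF c(1), of "4 * \<epsilon>"] by (intro ennreal_leI) (simp add: field_simps)
  finally show ?thesis .
qed

text \<open>Since \<open>s^2 + \<delta>\<close> is at most \<open>(s + sqrt \<delta>)^2\<close>, the
  modulus of \<open>y - b\<close> stays in an interval of length \<open>sqrt \<delta>\<close>; the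
  two signs of \<open>y - b\<close> give the factor 2.\<close>

lemma lborel_square_window:
  fixes b q \<delta> :: real
  assumes "0 \<le> \<delta>"
  shows "emeasure lborel {y. q \<le> (y - b)\<^sup>2 \<and> (y - b)\<^sup>2 \<le> q + \<delta>} \<le> ennreal (2 * sqrt \<delta>)"
proof -
  \<comment> \<open>The truncation at 0 covers negative \<open>q\<close>, for which the lower
    constraint is void.\<close>
  define s where "s = sqrt (max q 0)"
  have s: "0 \<le> s" "s\<^sup>2 = max q 0" by (auto simp: s_def)
  have "\<bar>y - b\<bar> \<in> {s..s + sqrt \<delta>}" if "q \<le> (y - b)\<^sup>2" "(y - b)\<^sup>2 \<le> q + \<delta>" for y
  proof -
    have "s\<^sup>2 \<le> \<bar>y - b\<bar>\<^sup>2" using that by (simp add: s)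
    then have "s \<le> \<bar>y - b\<bar>" by (rule power2_le_imp_le) simp
    moreover have "\<bar>y - b\<bar>\<^sup>2 \<le> (s + sqrt \<delta>)\<^sup>2"
      using that s assms by (simp add: power2_sum add_increasing2)
    then have "\<bar>y - b\<bar> \<le> s + sqrt \<delta>" by (rule power2_le_imp_le) (use s assms in simp)
    ultimately show ?thesis by simp
  qed
  then have "{y. q \<le> (y - b)\<^sup>2 \<and> (y - b)\<^sup>2 \<le> q + \<delta>} \<subseteq> {b + s..b + s + sqrt \<delta>} \<union> {b - s - sqrt \<delta>..b - s}"
    by (fastforce simp: abs_if split: if_splits)
  then have "emeasure lborel {y. q \<le> (y - b)\<^sup>2 \<and> (y - b)\<^sup>2 \<le> q + \<delta>}
      \<le> emeasure lborel ({b + s..b + s + sqrt \<delta>} \<union> {b - s - sqrt \<delta>..b - s})"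
    by (intro emeasure_mono) auto
  also have "\<dots> \<le> emeasure lborel {b + s..b + s + sqrt \<delta>} + emeasure lborel {b - s - sqrt \<delta>..b - s}"
    by (intro emeasure_subadditive) auto
  also have "\<dots> = ennreal (2 * sqrt \<delta>)"
    using assms by (simp flip: ennreal_plus)
  finally show ?thesis .
qed

section \<open>Iterates of the baker's map in coordinates\<close>

lemma frac_double_frac: "frac (2 * frac t) = frac (2 * t :: real)"
proof -
  have "2 * t - frac (2 * frac t) = of_int (2 * \<lfloor>t\<rfloor> + \<lfloor>2 * frac t\<rfloor>)"
    by (simp add: frac_def)
  then have "frac (2 * t) = frac (2 * frac t)"
    by (metis Ints_of_int frac_ge_0 frac_lt_1 frac_unique_iff)
  then show ?thesis ..
qed

lemma borel_measurable_baker [measurable]: "baker \<gamma> \<in> borel_measurable borel"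
proof -
  have [measurable]: "fst \<in> borel_measurable (borel :: (real \<times> real) measure)"
    "snd \<in> borel_measurable (borel :: (real \<times> real) measure)"
    by (simp_all add: borel_prod[symmetric])
  have "baker \<gamma> = (\<lambda>p. if snd p < 1 / 2 then (\<gamma> * fst p, 2 * snd p)
                      else ((1 - \<gamma>) + \<gamma> * fst p, 2 * snd p - 1))"
    by (auto simp: baker_def fun_eq_iff)
  then show ?thesis by simp
qed

lemma baker_unit_square:
  assumes "0 < \<gamma>" "\<gamma> < 1 / 2" "p \<in> unit_square"
  shows "baker \<gamma> p \<in> unit_square"
proof -
  obtain x y where p: "p = (x, y)" "0 \<le> x" "x \<le> 1" "0 \<le> y" "y \<le> 1"
    using assms(3) by (auto simp: unit_square_def)
  have "0 \<le> \<gamma> * x" "\<gamma> * x \<le> \<gamma>"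
    using assms p by (auto simp: mult_left_le)
  moreover have "\<gamma> * x \<le> 1" using assms p by (intro mult_le_one) auto
  ultimately show ?thesis using assms p by (auto simp: baker_def unit_square_def)
qed

text \<open>The ordinate follows the doubling map. The top edge is excluded because
  \<open>baker\<close> fixes the ordinate 1, whereas \<open>frac\<close> sends it to 0.\<close>

lemma snd_baker_funpow:
  assumes "0 \<le> y" "y < 1"
  shows "snd ((baker \<gamma> ^^ m) (x, y)) = frac (2 ^ m * y)"
proof (induction m)
  case 0
  then show ?case using assms by (simp add: frac_eq)
next
  case (Suc m)
  have snd_step: "snd (baker \<gamma> p) = frac (2 * snd p)" if "0 \<le> snd p" "snd p < 1" for p
  proof (cases p)
    case (Pair u v)
    have "frac (2 * v) = (if v < 1 / 2 then 2 * v else 2 * v - 1)"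
      using that Pair by (auto simp: frac_unique_iff)
    then show ?thesis using Pair by (simp add: baker_def)
  qed
  show ?case
    using Suc snd_step[of "(baker \<gamma> ^^ m) (x, y)"]
    by (simp add: frac_lt_1 frac_double_frac mult.assoc)
qed

text \<open>The branch taken depends on the ordinate only, and both branches have slope
  \<open>\<gamma>\<close> in the abscissa. Points of equal ordinate therefore share their itinerary
  and approach each other horizontally.\<close>

lemma
  fixes \<gamma> x x' y :: real
  shows snd_baker_funpow_cong: "snd ((baker \<gamma> ^^ j) (x, y)) = snd ((baker \<gamma> ^^ j) (x', y))"
  and fst_baker_funpow_diff:
    "fst ((baker \<gamma> ^^ j) (x, y)) - fst ((baker \<gamma> ^^ j) (x', y)) = \<gamma> ^ j * (x - x')"
proof (induction j)
  case (Suc j)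
  have "fst (baker \<gamma> p) - fst (baker \<gamma> q) = \<gamma> * (fst p - fst q) \<and> snd (baker \<gamma> p) = snd (baker \<gamma> q)"
    if "snd p = snd q" for p q
    using that by (auto simp: baker_def split_beta algebra_simps)
  note step = this[of "(baker \<gamma> ^^ j) (x, y)" "(baker \<gamma> ^^ j) (x', y)"]
  case 1 show ?case using Suc step by simp
  case 2 show ?case using Suc step by simp
qed simp_all

lemma dist_baker_funpow:
  assumes "0 \<le> \<gamma>"
  shows "dist ((baker \<gamma> ^^ j) (x, y)) ((baker \<gamma> ^^ j) (x', y)) = \<gamma> ^ j * \<bar>x - x'\<bar>"
  using assms fst_baker_funpow_diff[where \<gamma>=\<gamma> and j=j and x=x and x'=x' and y=y]
    snd_baker_funpow_cong[where \<gamma>=\<gamma> and j=j and x=x and x'=x' and y=y]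
  by (simp add: dist_prod_def dist_real_def abs_mult)

section \<open>The SRB measure and its vertical leaves\<close>

locale baker_srb =
  fixes \<gamma> :: real and \<mu> :: "(real \<times> real) measure"
  assumes gamma: "0 < \<gamma>" "\<gamma> < 1 / 2" and srb: "is_SRB_measure \<gamma> \<mu>"
begin

sublocale prob_space \<mu>
  using srb by (simp add: is_SRB_measure_def)

lemma unit_square_borel: "unit_square \<in> sets borel"
  by (simp add: unit_square_def closed_Times borel_closed)

lemma sets_mu [measurable_cong]: "sets \<mu> = sets (restrict_space borel unit_square)"
  using srb by (simp add: is_SRB_measure_def)

lemma space_mu: "space \<mu> = unit_square"
  using sets_eq_imp_space_eq[OF sets_mu] unit_square_borel by simp

lemma sets_mu_iff: "A \<in> sets \<mu> \<longleftrightarrow> A \<in> sets borel \<and> A \<subseteq> unit_square"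
  using unit_square_borel by (auto simp: sets_mu sets_restrict_space_iff)

lemma measurable_mu_borel:
  "f \<in> measurable borel N \<Longrightarrow> f \<in> measurable \<mu> N"
  by (subst measurable_cong_sets[OF sets_mu refl]) (rule measurable_restrict_space1)

lemma measurable_coords [measurable]: "fst \<in> borel_measurable \<mu>" "snd \<in> borel_measurable \<mu>"
  by (auto intro!: measurable_mu_borel simp flip: borel_prod)

lemma measurable_id_mu [measurable]: "(\<lambda>p. p) \<in> borel_measurable \<mu>"
  by (rule measurable_mu_borel) simp

lemma measurable_baker_mu [measurable]: "baker \<gamma> \<in> measurable \<mu> \<mu>"
proof -
  have "baker \<gamma> \<in> measurable (restrict_space borel unit_square) (restrict_space borel unit_square)"
    by (rule measurable_restrict_space3) (use gamma baker_unit_square in auto)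
  then show ?thesis by (simp add: measurable_cong_sets[OF sets_mu sets_mu])
qed

lemma baker_invariant: "distr \<mu> \<mu> (baker \<gamma>) = \<mu>"
  using srb by (simp add: is_SRB_measure_def)

text \<open>The endpoint 1 of a leaf is Lebesgue-null. Removing it leaves the half-open range on
  which the ordinate is governed exactly by the doubling map.\<close>

lemma emeasure_leaves:
  assumes "A \<in> sets \<mu>"
  shows "emeasure \<mu> A = (\<integral>\<^sup>+p. emeasure lborel {y \<in> {0..<1}. (fst p, y) \<in> A} \<partial>\<mu>)"
proof -
  have A: "A \<in> sets borel" using assms sets_mu_iff by auto
  have "emeasure (leaf_measure x) A = emeasure lborel {y \<in> {0..<1}. (x, y) \<in> A}" for x
  proof -
    have [measurable]: "Pair x \<in> measurable (uniform_measure lborel {0..1}) borel"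
      by (simp add: measurable_cong_sets[OF sets_uniform_measure refl] flip: borel_prod)
    have pre: "{y. (x, y) \<in> A} \<in> sets borel"
      using measurable_sets[of "Pair x" borel borel A] A by (simp add: vimage_def flip: borel_prod)
    have "emeasure (leaf_measure x) A = emeasure (uniform_measure lborel {0..1}) {y. (x, y) \<in> A}"
      unfolding leaf_measure_def by (subst emeasure_distr) (use A in \<open>auto simp: vimage_def\<close>)
    also have "\<dots> = emeasure lborel ({0..1} \<inter> {y. (x, y) \<in> A})"
      using pre by (simp add: divide_ennreal_def)
    also have "\<dots> = emeasure lborel ({0..<1} \<inter> {y. (x, y) \<in> A})"
    proof (rule emeasure_eq_AE)
      show "AE y in lborel. (y \<in> {0..1} \<inter> {y. (x, y) \<in> A}) = (y \<in> {0..<1} \<inter> {y. (x, y) \<in> A})"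
        using AE_lborel_singleton[of "1::real"] by eventually_elim auto
    qed (use pre in auto)
    finally show ?thesis by (simp add: Int_def)
  qed
  then show ?thesis using srb assms by (simp add: is_SRB_measure_def)
qed

text \<open>A bound that is uniform over the leaves survives averaging. This reduces estimates for
  \<open>\<mu>\<close> to one-dimensional Lebesgue estimates.\<close>

lemma prob_le_leaves:
  assumes "A \<in> sets \<mu>" "0 \<le> c"
    and "\<And>x. 0 \<le> x \<Longrightarrow> x \<le> 1 \<Longrightarrow> emeasure lborel {y \<in> {0..<1}. (x, y) \<in> A} \<le> ennreal c"
  shows "prob A \<le> c"
proof -
  have "emeasure \<mu> A \<le> (\<integral>\<^sup>+p. ennreal c \<partial>\<mu>)"
    unfolding emeasure_leaves[OF assms(1)]
    by (intro nn_integral_mono assms(3)) (auto simp: space_mu unit_square_def)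
  also have "\<dots> = ennreal c" by (simp add: emeasure_space_1)
  finally show ?thesis using assms(2) by (simp add: emeasure_eq_measure)
qed

end

section \<open>Measures of annuli, balls and near-return sets\<close>

lemma dist_unit_square_le_2:
  assumes "p \<in> unit_square" "q \<in> unit_square"
  shows "dist p q \<le> 2"
proof -
  have "dist p q \<le> \<bar>fst p - fst q\<bar> + \<bar>snd p - snd q\<bar>"
    using sqrt_sum_squares_le_sum_abs by (simp add: dist_prod_def dist_real_def)
  then show ?thesis using assms by (auto simp: unit_square_def)
qed

context baker_srb
begin

abbreviation "T \<equiv> baker \<gamma>"

lemma funpow_space: "p \<in> space \<mu> \<Longrightarrow> (T ^^ j) p \<in> space \<mu>"
  by (rule measurable_space[OF measurable_compose_n[OF measurable_baker_mu]])

lemma sets_square_ball [measurable]: "square_ball z r \<in> sets \<mu>"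
proof -
  have "square_ball z r = {p \<in> space \<mu>. dist p z < r}"
    by (simp add: square_ball_def space_mu)
  then show ?thesis by simp
qed

text \<open>On a vertical leaf the annulus becomes a window for the squared vertical distance to
  \<open>z\<close>. The square root reflects leaves that are tangent to the circle.\<close>

lemma prob_annulus:
  assumes z: "z \<in> unit_square" and r: "0 \<le> r" "r \<le> 1" and \<epsilon>: "0 \<le> \<epsilon>"
  shows "prob {p \<in> space \<mu>. \<bar>dist p z - r\<bar> \<le> \<epsilon>} \<le> 2 * sqrt (6 * \<epsilon>)"
proof (rule prob_le_leaves)
  fix x :: real assume x: "0 \<le> x" "x \<le> 1"
  obtain a b where ab: "z = (a, b)" by force
  \<comment> \<open>Distances in the square are at most 2 and \<open>r \<le> 1\<close>, so a
    distance within \<open>\<epsilon>\<close> of \<open>r\<close> has its square within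
    \<open>3 * \<epsilon>\<close> of the square of \<open>r\<close>.\<close>
  let ?q = "r\<^sup>2 - 3 * \<epsilon> - (x - a)\<^sup>2"
  have "?q \<le> (y - b)\<^sup>2 \<and> (y - b)\<^sup>2 \<le> ?q + 6 * \<epsilon>"
    if y: "y \<in> {0..<1}" and d: "\<bar>dist (x, y) z - r\<bar> \<le> \<epsilon>" for y
  proof -
    have le: "dist (x, y) z \<le> 2"
      by (intro dist_unit_square_le_2 z) (use x y in \<open>auto simp: unit_square_def\<close>)
    have "(dist (x, y) z)\<^sup>2 - r\<^sup>2 = (dist (x, y) z - r) * (dist (x, y) z + r)"
      by (simp add: power2_eq_square algebra_simps)
    then have "\<bar>(dist (x, y) z)\<^sup>2 - r\<^sup>2\<bar> = \<bar>dist (x, y) z - r\<bar> * (dist (x, y) z + r)"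
      using r by (simp add: abs_mult)
    also have "\<dots> \<le> \<epsilon> * 3"
      using d le r \<epsilon> by (intro mult_mono) auto
    finally have "\<bar>(dist (x, y) z)\<^sup>2 - r\<^sup>2\<bar> \<le> \<epsilon> * 3" .
    moreover have "(dist (x, y) z)\<^sup>2 = (x - a)\<^sup>2 + (y - b)\<^sup>2"
      by (simp add: ab dist_prod_def dist_real_def)
    ultimately show ?thesis by linarith
  qed
  then have "emeasure lborel {y \<in> {0..<1}. (x, y) \<in> {p \<in> space \<mu>. \<bar>dist p z - r\<bar> \<le> \<epsilon>}}
      \<le> emeasure lborel {y. ?q \<le> (y - b)\<^sup>2 \<and> (y - b)\<^sup>2 \<le> ?q + 6 * \<epsilon>}"
    by (intro emeasure_mono) auto
  also have "\<dots> \<le> ennreal (2 * sqrt (6 * \<epsilon>))"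
    by (rule lborel_square_window) (use \<epsilon> in simp)
  finally show "emeasure lborel {y \<in> {0..<1}. (x, y) \<in> {p \<in> space \<mu>. \<bar>dist p z - r\<bar> \<le> \<epsilon>}}
      \<le> ennreal (2 * sqrt (6 * \<epsilon>))" .
qed (use \<epsilon> in auto)

lemma prob_square_ball_le:
  assumes "0 \<le> r"
  shows "prob (square_ball z r) \<le> 2 * r"
proof (rule prob_le_leaves)
  fix x :: real
  obtain a b where ab: "z = (a, b)" by force
  have "\<bar>y - b\<bar> < r" if "dist (x, y) z < r" for y
    using dist_snd_le[of "(x, y)" z] that by (simp add: ab dist_real_def)
  then have "{y \<in> {0..<1}. (x, y) \<in> square_ball z r} \<subseteq> {b - r..b + r}"
    by (fastforce simp: square_ball_def abs_less_iff)
  then have "emeasure lborel {y \<in> {0..<1}. (x, y) \<in> square_ball z r} \<le> emeasure lborel {b - r..b + r}"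
    by (intro emeasure_mono) auto
  then show "emeasure lborel {y \<in> {0..<1}. (x, y) \<in> square_ball z r} \<le> ennreal (2 * r)"
    using assms by simp
qed (use assms in auto)

text \<open>A near return of the point forces a near return of its ordinate under the doubling map,
  whatever the abscissa does.\<close>

lemma prob_near_return:
  assumes "1 \<le> j" "0 \<le> \<epsilon>"
  shows "prob {p \<in> space \<mu>. dist p ((T ^^ j) p) < \<epsilon>} \<le> 4 * \<epsilon>"
proof (rule prob_le_leaves)
  fix x :: real
  have "\<bar>frac (2 ^ j * y) - y\<bar> < \<epsilon>" if "y \<in> {0..<1}" "dist (x, y) ((T ^^ j) (x, y)) < \<epsilon>" for y
    using dist_snd_le[of "(T ^^ j) (x, y)" "(x, y)"] that
    by (simp add: dist_real_def snd_baker_funpow dist_commute)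
  then have "emeasure lborel {y \<in> {0..<1}. (x, y) \<in> {p \<in> space \<mu>. dist p ((T ^^ j) p) < \<epsilon>}}
     \<le> emeasure lborel {y \<in> {0..<1}. \<bar>frac (2 ^ j * y) - y\<bar> < \<epsilon>}"
    by (intro emeasure_mono) (auto simp: frac_def)
  also have "\<dots> \<le> ennreal (4 * \<epsilon>)" by (rule lborel_near_fixed_frac) (use assms in auto)
  finally show "emeasure lborel {y \<in> {0..<1}. (x, y) \<in> {p \<in> space \<mu>. dist p ((T ^^ j) p) < \<epsilon>}}
     \<le> ennreal (4 * \<epsilon>)" .
qed (use assms in auto)

section \<open>Mixing along the leaves\<close>

lemma measurable_leaf:
  assumes "A \<in> sets \<mu>"
  shows "(\<lambda>p. emeasure lborel {y \<in> {0..<1}. (fst p, y) \<in> A}) \<in> borel_measurable \<mu>"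
proof -
  have A: "A \<in> sets (borel \<Otimes>\<^sub>M lborel)"
    using assms sets_mu_iff
    by (subst sets_pair_measure_cong[OF refl sets_lborel], subst borel_prod) simp
  have "UNIV \<times> {0..<1::real} \<in> sets (borel \<Otimes>\<^sub>M lborel)" by auto
  then have "(\<lambda>x. emeasure lborel (Pair x -` (A \<inter> UNIV \<times> {0..<1}))) \<in> borel_measurable (borel :: real measure)"
    by (intro lborel.measurable_emeasure_Pair sets.Int A)
  moreover have "Pair x -` (A \<inter> UNIV \<times> {0..<1}) = {y \<in> {0..<1}. (x, y) \<in> A}" for x
    by auto
  ultimately show ?thesis by (simp add: measurable_compose[OF measurable_coords(1)])
qed

text \<open>On a leaf, \<open>P\<close> sees only the first \<open>m\<close> binary digits of the
  ordinate and \<open>G\<close> only the later ones. The factor coming from \<open>G\<close> is the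
  same on all leaves, so it can be pulled out of the integral.\<close>

lemma leafwise_independent:
  assumes A[measurable]: "{p \<in> space \<mu>. P (fst p) \<lfloor>2 ^ m * snd p\<rfloor>} \<in> sets \<mu>"
    and G[measurable]: "G \<in> sets borel"
  shows "prob ({p \<in> space \<mu>. P (fst p) \<lfloor>2 ^ m * snd p\<rfloor>} \<inter> {p \<in> space \<mu>. snd ((T ^^ m) p) \<in> G})
       = prob {p \<in> space \<mu>. P (fst p) \<lfloor>2 ^ m * snd p\<rfloor>} * prob {p \<in> space \<mu>. snd ((T ^^ m) p) \<in> G}"
proof -
  let ?F = "{p \<in> space \<mu>. snd ((T ^^ m) p) \<in> G}"
  have F[measurable]: "?F \<in> sets \<mu>" by measurable
  have *: "emeasure \<mu> ({p \<in> space \<mu>. R (fst p) \<lfloor>2 ^ m * snd p\<rfloor>} \<inter> ?F)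
      = emeasure \<mu> {p \<in> space \<mu>. R (fst p) \<lfloor>2 ^ m * snd p\<rfloor>} * emeasure lborel (G \<inter> {0..<1})"
    if R[measurable]: "{p \<in> space \<mu>. R (fst p) \<lfloor>2 ^ m * snd p\<rfloor>} \<in> sets \<mu>" for R
  proof -
    have leaf: "{y \<in> {0..<1}. (x, y) \<in> {p \<in> space \<mu>. R (fst p) \<lfloor>2 ^ m * snd p\<rfloor>} \<inter> ?F}
        = {y \<in> {0..<1}. R x \<lfloor>2 ^ m * y\<rfloor> \<and> frac (2 ^ m * y) \<in> G}"
      "{y \<in> {0..<1}. (x, y) \<in> {p \<in> space \<mu>. R (fst p) \<lfloor>2 ^ m * snd p\<rfloor>}}
        = {y \<in> {0..<1::real}. R x \<lfloor>2 ^ m * y\<rfloor>}" if "0 \<le> x" "x \<le> 1" for x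
      using that by (auto simp: snd_baker_funpow space_mu unit_square_def)
    have "emeasure \<mu> ({p \<in> space \<mu>. R (fst p) \<lfloor>2 ^ m * snd p\<rfloor>} \<inter> ?F)
        = (\<integral>\<^sup>+p. emeasure lborel {y \<in> {0..<1::real}. R (fst p) \<lfloor>2 ^ m * y\<rfloor> \<and> frac (2 ^ m * y) \<in> G} \<partial>\<mu>)"
      unfolding emeasure_leaves[OF sets.Int[OF R F]]
      by (intro nn_integral_cong arg_cong[where f="emeasure lborel"] leaf)
        (auto simp: space_mu unit_square_def)
    also have "\<dots> = (\<integral>\<^sup>+p. emeasure lborel {y \<in> {0..<1::real}. R (fst p) \<lfloor>2 ^ m * y\<rfloor>}
        * emeasure lborel (G \<inter> {0..<1}) \<partial>\<mu>)"
      by (intro nn_integral_cong lborel_dyadic_independent G)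
    also have "\<dots> = (\<integral>\<^sup>+p. emeasure lborel {y \<in> {0..<1}. (fst p, y) \<in> {p \<in> space \<mu>. R (fst p) \<lfloor>2 ^ m * snd p\<rfloor>}}
        * emeasure lborel (G \<inter> {0..<1}) \<partial>\<mu>)"
      by (intro nn_integral_cong arg_cong2[where f="(*)"] arg_cong[where f="emeasure lborel"] refl leaf[symmetric])
        (auto simp: space_mu unit_square_def)
    also have "\<dots> = emeasure \<mu> {p \<in> space \<mu>. R (fst p) \<lfloor>2 ^ m * snd p\<rfloor>} * emeasure lborel (G \<inter> {0..<1})"
      unfolding emeasure_leaves[OF R] by (intro nn_integral_multc measurable_leaf R)
    finally show ?thesis .
  qed
  \<comment> \<open>With \<open>R\<close> identically true, the product formula gives the measure of
    \<open>?F\<close> itself.\<close>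
  have "emeasure \<mu> ?F = emeasure lborel (G \<inter> {0..<1})"
    using *[of "\<lambda>_ _. True"] F by (simp add: emeasure_space_1 Int_absorb1 sets.sets_into_space)
  then have "emeasure \<mu> ({p \<in> space \<mu>. P (fst p) \<lfloor>2 ^ m * snd p\<rfloor>} \<inter> ?F)
      = emeasure \<mu> {p \<in> space \<mu>. P (fst p) \<lfloor>2 ^ m * snd p\<rfloor>} * emeasure \<mu> ?F"
    using *[OF A] by simp
  then show ?thesis
    by (simp add: emeasure_eq_measure flip: ennreal_mult)
qed

text \<open>The first \<open>m\<close> steps of the gap use up the digits that determine
  \<open>?A'\<close>; the next \<open>m\<close> steps make the abscissa irrelevant up to
  \<open>\<gamma> ^ m\<close>, which is at most \<open>1 / 2 ^ m\<close>. Either approximation can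
  fail only at points within \<open>1 / 2 ^ m\<close> of the sphere of radius \<open>r\<close>, once
  for \<open>A\<close> and once for each of the \<open>N\<close> avoidance times.\<close>

lemma avoid_ball_mixing:
  assumes z: "z \<in> unit_square" and r: "0 \<le> r" "r \<le> 1"
  defines "A \<equiv> square_ball z r"
  shows "\<bar>prob (A \<inter> {p \<in> space \<mu>. (T ^^ (2 * m)) p \<in> avoiding \<mu> T A N})
      - prob A * prob (avoiding \<mu> T A N)\<bar> \<le> 2 * (real N + 1) * (2 * sqrt (6 * (1 / 2 ^ m)))"
proof -
  let ?e = "1 / 2 ^ m :: real"
  let ?\<kappa> = "2 * sqrt (6 * ?e)"
  let ?D = "{p \<in> space \<mu>. \<bar>dist p z - r\<bar> \<le> ?e}"
  let ?A' = "{p \<in> space \<mu>. dist (fst p, real_of_int \<lfloor>2 ^ m * snd p\<rfloor> / 2 ^ m) z < r}"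
  \<comment> \<open>The abscissa at time \<open>m\<close> is replaced by the reference value 0, so
    that the event depends on the ordinate alone.\<close>
  let ?G = "{y. \<forall>j<N. \<not> dist ((T ^^ (j + m)) (0, y)) z < r}"
  let ?F = "{p \<in> space \<mu>. (T ^^ (2 * m)) p \<in> avoiding \<mu> T A N}"
  let ?F' = "{p \<in> space \<mu>. snd ((T ^^ m) p) \<in> ?G}"
  have [measurable]: "A \<in> sets \<mu>" unfolding A_def by measurable
  have A_eq: "A = {p \<in> space \<mu>. dist p z < r}" by (simp add: A_def square_ball_def space_mu)
  note sets_avoiding[OF measurable_baker_mu, measurable]
  have G[measurable]: "?G \<in> sets borel"
  proof -
    have [measurable]: "Pair 0 \<in> measurable borel (borel :: (real \<times> real) measure)"
      by (simp flip: borel_prod)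
    show ?thesis by measurable
  qed
  have A'[measurable]: "?A' \<in> sets \<mu>"
  proof -
    have [measurable]: "(\<lambda>p. (fst p, real_of_int \<lfloor>2 ^ m * snd p\<rfloor> / 2 ^ m)) \<in> borel_measurable \<mu>"
      by (intro borel_measurable_Pair) measurable
    show ?thesis by measurable
  qed
  have D[measurable]: "?D \<in> sets \<mu>" by measurable
  have D_le: "prob ?D \<le> ?\<kappa>" by (rule prob_annulus[OF z r]) simp
  have near: "\<bar>dist p z - r\<bar> \<le> ?e" if "dist p q \<le> ?e" "(dist p z < r) \<noteq> (dist q z < r)" for p q
    using that dist_triangle[of p z q] dist_triangle[of q z p] by (simp add: dist_commute) linarith
  have "\<bar>prob (A \<inter> ?F) - prob A * prob ?F\<bar> \<le> 2 * (?\<kappa> + real N * ?\<kappa>)"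
  proof (rule near_independent)
    show "prob (?A' \<inter> ?F') = prob ?A' * prob ?F'"
      by (rule leafwise_independent[where P="\<lambda>x i. dist (x, real_of_int i / 2 ^ m) z < r"]) (use A' G in simp_all)
    show "A - ?A' \<union> (?A' - A) \<subseteq> ?D"
    proof
      fix p assume p: "p \<in> A - ?A' \<union> (?A' - A)"
      let ?q = "(fst p, real_of_int \<lfloor>2 ^ m * snd p\<rfloor> / 2 ^ m)"
      have "dist p ?q = \<bar>snd p - real_of_int \<lfloor>2 ^ m * snd p\<rfloor> / 2 ^ m\<bar>"
        by (simp add: dist_prod_def dist_real_def)
      also have "\<dots> = \<bar>frac (2 ^ m * snd p)\<bar> / 2 ^ m"
        by (simp add: frac_def field_simps)
      also have "\<dots> \<le> ?e"
        by (intro divide_right_mono) (auto simp: less_imp_le[OF frac_lt_1])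
      finally have "\<bar>dist p z - r\<bar> \<le> ?e" by (rule near) (use p in \<open>auto simp: A_eq\<close>)
      then show "p \<in> ?D" using p by (auto simp: A_eq)
    qed
    show "?F - ?F' \<union> (?F' - ?F) \<subseteq> (\<Union>j<N. {p \<in> space \<mu>. (T ^^ (j + 2 * m)) p \<in> ?D})"
    proof
      fix p assume p: "p \<in> ?F - ?F' \<union> (?F' - ?F)"
      then have sp: "p \<in> space \<mu>" by auto
      obtain x y where xy: "(T ^^ m) p = (x, y)" by force
      have x: "0 \<le> x" "x \<le> 1" using funpow_space[OF sp, of m] by (auto simp: xy space_mu unit_square_def)
      have "p \<in> ?F \<longleftrightarrow> (\<forall>j<N. \<not> dist ((T ^^ (j + 2 * m)) p) z < r)"
        using sp funpow_space[OF sp] by (simp add: avoiding_def A_eq flip: funpow_add[THEN fun_cong, unfolded o_def])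
      moreover have "p \<in> ?F' \<longleftrightarrow> (\<forall>j<N. \<not> dist ((T ^^ (j + m)) (0, y)) z < r)"
        using sp by (simp add: xy)
      ultimately obtain j where j: "j < N"
        "(dist ((T ^^ (j + 2 * m)) p) z < r) \<noteq> (dist ((T ^^ (j + m)) (0, y)) z < r)"
        using p by blast
      have "(T ^^ (j + 2 * m)) p = (T ^^ (j + m)) (x, y)"
        by (simp add: funpow_add mult_2 flip: xy)
      then have "dist ((T ^^ (j + 2 * m)) p) ((T ^^ (j + m)) (0, y)) = \<gamma> ^ (j + m) * \<bar>x - 0\<bar>"
        using dist_baker_funpow[of \<gamma> "j + m" x y 0] gamma by simp
      also have "\<dots> \<le> \<gamma> ^ (j + m) * 1"
        using x gamma by (intro mult_left_mono) auto
      also have "\<dots> \<le> \<gamma> ^ m"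
        using gamma by (simp add: power_decreasing)
      also have "\<dots> \<le> (1 / 2) ^ m"
        using gamma by (intro power_mono) auto
      finally have "\<bar>dist ((T ^^ (j + 2 * m)) p) z - r\<bar> \<le> ?e"
        by (intro near) (use j in \<open>auto simp: power_one_over\<close>)
      then show "p \<in> (\<Union>j<N. {p \<in> space \<mu>. (T ^^ (j + 2 * m)) p \<in> ?D})"
        using j sp funpow_space by auto
    qed
    have "prob (\<Union>j<N. {p \<in> space \<mu>. (T ^^ (j + 2 * m)) p \<in> ?D})
        \<le> (\<Sum>j<N. prob {p \<in> space \<mu>. (T ^^ (j + 2 * m)) p \<in> ?D})"
      by (intro finite_measure_subadditive_finite) auto
    also have "\<dots> \<le> (\<Sum>j<N. ?\<kappa>)"
      using D_le by (intro sum_mono) (simp only: prob_funpow_vimage[OF measurable_baker_mu baker_invariant D])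
    finally show "prob (\<Union>j<N. {p \<in> space \<mu>. (T ^^ (j + 2 * m)) p \<in> ?D}) \<le> real N * ?\<kappa>"
      by simp
  qed (use D_le in measurable)
  moreover have "prob ?F = prob (avoiding \<mu> T A N)"
    by (rule prob_funpow_vimage[OF measurable_baker_mu baker_invariant]) measurable
  ultimately show ?thesis by (simp add: algebra_simps)
qed

end

section \<open>Sparsity of near returns around typical points\<close>

lemma floor_diff_le:
  fixes x y s :: real
  assumes "\<bar>x - y\<bar> < d" "s > 0" "d * s \<le> real n"
  shows "\<bar>\<lfloor>x * s\<rfloor> - \<lfloor>y * s\<rfloor>\<bar> \<le> int n"
proof -
  have "\<bar>x * s - y * s\<bar> = \<bar>x - y\<bar> * s"
    using assms by (simp add: abs_mult flip: left_diff_distrib)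
  also have "\<dots> < d * s" using assms by simp
  finally have "\<bar>x * s - y * s\<bar> < real n" using assms by simp
  then show ?thesis by linarith
qed

context baker_srb
begin

text \<open>This is a weak-type estimate on a grid. The bad cells are those too light for
  \<open>\<eta>\<close> and those whose mass is small compared with the part of \<open>E\<close> in
  the surrounding block of 81 cells. A good cell lies in the smaller ball about each of its points,
  and its block contains the larger ball.\<close>

lemma density_exceptional_set:
  assumes E[measurable]: "E \<in> sets \<mu>" and \<epsilon>: "0 < \<epsilon>" and \<eta>: "0 \<le> \<eta>"
  shows "\<exists>B\<in>sets \<mu>. prob B \<le> 81 * prob E / \<epsilon> + (2 ^ (k + 2) + 1)\<^sup>2 * \<eta> \<and>
    (\<forall>z\<in>space \<mu> - B. \<eta> \<le> prob (square_ball z (1 / 2 ^ (k + 1))) \<and>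
       prob (square_ball z (1 / 2 ^ k) \<inter> E) \<le> \<epsilon> * prob (square_ball z (1 / 2 ^ (k + 1))))"
proof -
  \<comment> \<open>With mesh \<open>1 / s\<close>, two points of a cell are closer than
    \<open>2 / s = 1 / 2 ^ (k + 1)\<close>, and the radius \<open>1 / 2 ^ k\<close> spans 4 cells;
    hence the range \<open>- 4..4\<close> in \<open>J\<close>.\<close>
  define s :: real where "s = 2 ^ (k + 2)"
  have s: "s > 0" by (simp add: s_def)
  define idx where "idx p = (\<lfloor>fst p * s\<rfloor>, \<lfloor>snd p * s\<rfloor>)" for p :: "real \<times> real"
  define Q where "Q c = {p \<in> space \<mu>. idx p = c}" for c
  \<comment> \<open>The upper index is included because a coordinate equal to 1 has index
    \<open>2 ^ (k + 2)\<close>.\<close>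
  define I where "I = {0..2 ^ (k + 2) :: int} \<times> {0..2 ^ (k + 2) :: int}"
  define J where "J = {- 4..4 :: int} \<times> {- 4..4 :: int}"
  define sh where "sh d c = (fst c + fst d, snd c + snd d)" for c d :: "int \<times> int"
  define N where "N c = (\<Union>d\<in>J. Q (sh d c))" for c
  define I1 where "I1 = {c \<in> I. \<epsilon> * prob (Q c) < prob (E \<inter> N c)}"
  define I2 where "I2 = {c \<in> I. prob (Q c) < \<eta>}"
  define B where "B = (\<Union>c\<in>I1. Q c) \<union> (\<Union>c\<in>I2. Q c)"
  have fin: "finite I" "finite J" "finite I1" "finite I2"
    by (auto simp: I_def J_def I1_def I2_def)
  have Q[measurable]: "Q c \<in> sets \<mu>" for c
    unfolding Q_def idx_def prod_eq_iff by measurable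
  have N[measurable]: "N c \<in> sets \<mu>" for c
    unfolding N_def using fin by (intro sets.finite_UN) auto
  have idx_I: "idx p \<in> I" if "p \<in> space \<mu>" for p
  proof -
    have "\<lfloor>t * s\<rfloor> \<in> {0..2 ^ (k + 2)}" if "0 \<le> t" "t \<le> 1" for t
    proof -
      have "t * s \<le> 1 * s" using that s by (intro mult_right_mono) auto
      then have "\<lfloor>t * s\<rfloor> \<le> \<lfloor>s\<rfloor>" by (intro floor_mono) simp
      also have "\<lfloor>s\<rfloor> = 2 ^ (k + 2)"
        unfolding s_def by (metis floor_of_int of_int_numeral of_int_power)
      finally show ?thesis using that s by simp
    qed
    then show ?thesis using that by (auto simp: idx_def I_def space_mu unit_square_def)
  qed
  have cell_ball: "Q (idx z) \<subseteq> square_ball z (1 / 2 ^ (k + 1))" for z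
  proof
    fix p assume "p \<in> Q (idx z)"
    then have sp: "p \<in> space \<mu>"
      and eq: "\<lfloor>fst p * s\<rfloor> = \<lfloor>fst z * s\<rfloor>" "\<lfloor>snd p * s\<rfloor> = \<lfloor>snd z * s\<rfloor>"
      by (auto simp: Q_def idx_def)
    have "\<bar>fst p * s - fst z * s\<bar> < 1" "\<bar>snd p * s - snd z * s\<bar> < 1"
      using eq by linarith+
    then have "\<bar>fst p - fst z\<bar> * s < 1" "\<bar>snd p - snd z\<bar> * s < 1"
      using s by (simp_all add: abs_mult flip: left_diff_distrib)
    then have "(\<bar>fst p - fst z\<bar> + \<bar>snd p - snd z\<bar>) * s < 2"
      by (simp add: distrib_right)
    moreover have "dist p z \<le> \<bar>fst p - fst z\<bar> + \<bar>snd p - snd z\<bar>"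
      using sqrt_sum_squares_le_sum_abs by (simp add: dist_prod_def dist_real_def)
    then have "dist p z * s \<le> (\<bar>fst p - fst z\<bar> + \<bar>snd p - snd z\<bar>) * s"
      using s by (intro mult_right_mono) auto
    ultimately have "dist p z * s < 2" by simp
    then show "p \<in> square_ball z (1 / 2 ^ (k + 1))"
      using sp by (simp add: s_def square_ball_def space_mu field_simps)
  qed
  have ball_nbhd: "square_ball z (1 / 2 ^ k) \<subseteq> N (idx z)" for z
  proof
    fix p assume "p \<in> square_ball z (1 / 2 ^ k)"
    then have sp: "p \<in> space \<mu>" and d: "dist p z < 1 / 2 ^ k"
      by (auto simp: square_ball_def space_mu)
    have "\<bar>fst p - fst z\<bar> < 1 / 2 ^ k" "\<bar>snd p - snd z\<bar> < 1 / 2 ^ k"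
      using d dist_fst_le[of p z] dist_snd_le[of p z] by (auto simp: dist_real_def)
    moreover have "1 / 2 ^ k * s \<le> real 4" by (simp add: s_def)
    ultimately have "\<bar>\<lfloor>fst p * s\<rfloor> - \<lfloor>fst z * s\<rfloor>\<bar> \<le> int 4" "\<bar>\<lfloor>snd p * s\<rfloor> - \<lfloor>snd z * s\<rfloor>\<bar> \<le> int 4"
      using floor_diff_le s by blast+
    then have "(fst (idx p) - fst (idx z), snd (idx p) - snd (idx z)) \<in> J"
      by (auto simp: J_def idx_def)
    moreover have "sh (fst (idx p) - fst (idx z), snd (idx p) - snd (idx z)) (idx z) = idx p"
      by (simp add: sh_def)
    ultimately show "p \<in> N (idx z)"
      using sp unfolding N_def Q_def by force
  qed
  have "prob (\<Union>c\<in>I1. Q c) \<le> (\<Sum>c\<in>I1. prob (Q c))"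
    using fin by (intro finite_measure_subadditive_finite) auto
  also have "\<dots> \<le> (\<Sum>c\<in>I1. prob (E \<inter> N c) / \<epsilon>)"
    using \<epsilon> by (intro sum_mono) (auto simp: I1_def field_simps)
  also have "\<dots> \<le> (\<Sum>c\<in>I. prob (E \<inter> N c) / \<epsilon>)"
    using \<epsilon> fin by (intro sum_mono2) (auto simp: I1_def)
  also have "\<dots> \<le> (\<Sum>c\<in>I. (\<Sum>d\<in>J. prob (E \<inter> Q (sh d c))) / \<epsilon>)"
  proof (intro sum_mono divide_right_mono)
    fix c
    have "E \<inter> N c = (\<Union>d\<in>J. E \<inter> Q (sh d c))" by (auto simp: N_def)
    then show "prob (E \<inter> N c) \<le> (\<Sum>d\<in>J. prob (E \<inter> Q (sh d c)))"
      using fin by (simp only:) (intro finite_measure_subadditive_finite; auto)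
  qed (use \<epsilon> in simp)
  also have "\<dots> = (\<Sum>d\<in>J. \<Sum>c\<in>I. prob (E \<inter> Q (sh d c))) / \<epsilon>"
    by (subst sum.swap) (simp add: sum_divide_distrib)
  \<comment> \<open>For a fixed shift \<open>d\<close> the cells \<open>Q (sh d c)\<close> are
    pairwise disjoint, so each of the 81 shifts counts \<open>E\<close> at most once.\<close>
  also have "\<dots> \<le> (\<Sum>d\<in>J. prob E) / \<epsilon>"
  proof (intro sum_mono divide_right_mono)
    fix d
    have "(\<Sum>c\<in>I. prob (E \<inter> Q (sh d c))) = prob (\<Union>c\<in>I. E \<inter> Q (sh d c))"
      using fin
      by (intro finite_measure_finite_Union[symmetric])
        (auto simp: disjoint_family_on_def sh_def prod_eq_iff, auto simp: Q_def)
    also have "\<dots> \<le> prob E" by (intro finite_measure_mono) auto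
    finally show "(\<Sum>c\<in>I. prob (E \<inter> Q (sh d c))) \<le> prob E" .
  qed (use \<epsilon> in simp)
  also have "(\<Sum>d\<in>J. prob E) / \<epsilon> = 81 * prob E / \<epsilon>"
    by (simp add: J_def)
  finally have 1: "prob (\<Union>c\<in>I1. Q c) \<le> 81 * prob E / \<epsilon>" .
  have "prob (\<Union>c\<in>I2. Q c) \<le> (\<Sum>c\<in>I2. prob (Q c))"
    using fin by (intro finite_measure_subadditive_finite) auto
  also have "\<dots> \<le> (\<Sum>c\<in>I2. \<eta>)"
    by (intro sum_mono) (auto simp: I2_def)
  also have "\<dots> \<le> (\<Sum>c\<in>I. \<eta>)"
    using \<eta> fin by (intro sum_mono2) (auto simp: I2_def)
  also have "\<dots> = (2 ^ (k + 2) + 1)\<^sup>2 * \<eta>"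
    by (simp add: I_def card_cartesian_product power2_eq_square nat_add_distrib nat_mult_distrib nat_power_eq
        algebra_simps)
  finally have 2: "prob (\<Union>c\<in>I2. Q c) \<le> (2 ^ (k + 2) + 1)\<^sup>2 * \<eta>" .
  have UN: "(\<Union>c\<in>I1. Q c) \<in> sets \<mu>" "(\<Union>c\<in>I2. Q c) \<in> sets \<mu>"
    using fin by auto
  have "prob B \<le> prob (\<Union>c\<in>I1. Q c) + prob (\<Union>c\<in>I2. Q c)"
    unfolding B_def by (intro measure_Un_le UN)
  moreover have "B \<in> sets \<mu>" unfolding B_def using UN by auto
  moreover have "\<eta> \<le> prob (square_ball z (1 / 2 ^ (k + 1))) \<and>
       prob (square_ball z (1 / 2 ^ k) \<inter> E) \<le> \<epsilon> * prob (square_ball z (1 / 2 ^ (k + 1)))"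
    if z: "z \<in> space \<mu> - B" for z
  proof -
    have "z \<in> Q (idx z)" "idx z \<in> I" using z idx_I by (auto simp: Q_def)
    moreover from this have "idx z \<notin> I1" "idx z \<notin> I2" using z by (auto simp: B_def)
    ultimately have c: "\<eta> \<le> prob (Q (idx z))" "prob (E \<inter> N (idx z)) \<le> \<epsilon> * prob (Q (idx z))"
      by (simp_all add: I1_def I2_def not_less)
    have le: "prob (Q (idx z)) \<le> prob (square_ball z (1 / 2 ^ (k + 1)))"
      by (intro finite_measure_mono cell_ball) auto
    have "prob (square_ball z (1 / 2 ^ k) \<inter> E) \<le> prob (E \<inter> N (idx z))"
      using ball_nbhd[of z] by (intro finite_measure_mono) auto
    also have "\<dots> \<le> \<epsilon> * prob (Q (idx z))" by (rule c)
    also have "\<dots> \<le> \<epsilon> * prob (square_ball z (1 / 2 ^ (k + 1)))"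
      using le \<epsilon> by (intro mult_left_mono) auto
    finally show ?thesis using c le by linarith
  qed
  ultimately show ?thesis using 1 2 by (intro bexI[of _ B]) auto
qed

text \<open>Two points of a ball of radius \<open>1 / 2 ^ k\<close> are less than
  \<open>2 / 2 ^ k\<close> apart. The times run up to the mixing gap \<open>2 * m\<close> for
  \<open>m\<close> equal to the square of \<open>k\<close>.\<close>

definition near_returns :: "nat \<Rightarrow> (real \<times> real) set" where
  "near_returns k = (\<Union>j\<in>{1..<2 * k\<^sup>2}. {p \<in> space \<mu>. dist p ((T ^^ j) p) < 2 / 2 ^ k})"

lemma sets_near_returns [measurable]: "near_returns k \<in> sets \<mu>"
proof -
  have [measurable]: "(T ^^ j) \<in> borel_measurable \<mu>" for j
    using measurable_compose[OF measurable_compose_n[OF measurable_baker_mu] measurable_id_mu] .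
  show ?thesis unfolding near_returns_def by measurable
qed

lemma prob_near_returns: "prob (near_returns k) \<le> 16 * (real k)\<^sup>2 / 2 ^ k"
proof -
  have [measurable]: "(T ^^ j) \<in> borel_measurable \<mu>" for j
    using measurable_compose[OF measurable_compose_n[OF measurable_baker_mu] measurable_id_mu] .
  have "prob (near_returns k) \<le> (\<Sum>j\<in>{1..<2 * k\<^sup>2}. prob {p \<in> space \<mu>. dist p ((T ^^ j) p) < 2 / 2 ^ k})"
    unfolding near_returns_def by (intro finite_measure_subadditive_finite) auto
  also have "\<dots> \<le> (\<Sum>j\<in>{1..<2 * k\<^sup>2}. 4 * (2 / 2 ^ k))"
    by (intro sum_mono prob_near_return) auto
  also have "\<dots> = real (2 * k\<^sup>2 - 1) * (8 / 2 ^ k)" by simp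
  also have "\<dots> \<le> (2 * (real k)\<^sup>2) * (8 / 2 ^ k)"
    by (intro mult_right_mono) (auto simp flip: of_nat_power)
  finally show ?thesis by simp
qed

text \<open>Borel-Cantelli for the exceptional sets. The ratio \<open>3 / 4\<close> lies above
  \<open>1 / 2\<close>, so that dividing the measure of \<open>near_returns k\<close> by its power
  stays summable, and below 1, so that the proportion decays. Of order \<open>4 ^ k\<close> cells
  lighter than \<open>1 / 8 ^ k\<close> have total mass of order \<open>1 / 2 ^ k\<close>.\<close>

lemma AE_rare_near_returns:
  "AE z in \<mu>. \<forall>\<^sub>F k in sequentially. 1 / 8 ^ k \<le> prob (square_ball z (1 / 2 ^ (k + 1))) \<and>
     prob (square_ball z (1 / 2 ^ k) \<inter> near_returns k) \<le> (3 / 4) ^ k * prob (square_ball z (1 / 2 ^ (k + 1)))"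
proof -
  have "\<exists>B\<in>sets \<mu>. prob B \<le> 81 * prob (near_returns k) / (3 / 4) ^ k + (2 ^ (k + 2) + 1)\<^sup>2 * (1 / 8 ^ k) \<and>
    (\<forall>z\<in>space \<mu> - B. 1 / 8 ^ k \<le> prob (square_ball z (1 / 2 ^ (k + 1))) \<and>
     prob (square_ball z (1 / 2 ^ k) \<inter> near_returns k) \<le> (3 / 4) ^ k * prob (square_ball z (1 / 2 ^ (k + 1))))" for k
    by (rule density_exceptional_set) auto
  then obtain B where B: "\<And>k. B k \<in> sets \<mu>"
    "\<And>k. prob (B k) \<le> 81 * prob (near_returns k) / (3 / 4) ^ k + (2 ^ (k + 2) + 1)\<^sup>2 * (1 / 8 ^ k)"
    "\<And>k z. z \<in> space \<mu> - B k \<Longrightarrow> 1 / 8 ^ k \<le> prob (square_ball z (1 / 2 ^ (k + 1))) \<and>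
     prob (square_ball z (1 / 2 ^ k) \<inter> near_returns k) \<le> (3 / 4) ^ k * prob (square_ball z (1 / 2 ^ (k + 1)))"
    by metis
  have "summable (\<lambda>k. prob (B k))"
  proof (rule summable_comparison_test)
    \<comment> \<open>Here 1296 is \<open>81 * 16\<close>, and 25 comes from bounding
      \<open>2 ^ (k + 2) + 1\<close> by \<open>5 * 2 ^ k\<close>.\<close>
    let ?f = "\<lambda>k. 1296 * ((real k)\<^sup>2 * (2 / 3) ^ k) + 25 * (1 / 2) ^ k"
    have "(\<lambda>k. (real k)\<^sup>2 * (2 / 3) ^ k) \<in> O(\<lambda>k. (3 / 4 :: real) ^ k)" by real_asymp
    then have "summable (\<lambda>k. (real k)\<^sup>2 * (2 / 3) ^ k)"
      by (rule summable_comparison_test_bigo[rotated]) simp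
    then show "summable ?f"
      by (intro summable_add summable_mult) simp_all
    have "norm (prob (B k)) \<le> ?f k" for k
    proof -
      have "81 * prob (near_returns k) / (3 / 4) ^ k \<le> 81 * (16 * (real k)\<^sup>2 / 2 ^ k) / (3 / 4) ^ k"
        by (intro divide_right_mono mult_left_mono prob_near_returns) auto
      also have "\<dots> = 1296 * ((real k)\<^sup>2 * ((1 / 2) ^ k / (3 / 4) ^ k))"
        by (simp add: power_one_over)
      also have "(1 / 2) ^ k / (3 / 4) ^ k = (2 / 3 :: real) ^ k"
        by (simp flip: power_divide)
      finally have "81 * prob (near_returns k) / (3 / 4) ^ k \<le> 1296 * ((real k)\<^sup>2 * (2 / 3) ^ k)" .
      moreover have "(2 ^ (k + 2) + 1)\<^sup>2 * (1 / 8 ^ k) \<le> 25 * (1 / 2 :: real) ^ k"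
      proof -
        have "(2 ^ (k + 2) + 1 :: real)\<^sup>2 \<le> (5 * 2 ^ k)\<^sup>2" by (intro power_mono) auto
        then have "(2 ^ (k + 2) + 1)\<^sup>2 * (1 / 8 ^ k) \<le> (5 * 2 ^ k)\<^sup>2 * (1 / 8 ^ k :: real)"
          by (intro mult_right_mono) auto
        also have "\<dots> = 25 * (2 ^ k * 2 ^ k * (1 / 8) ^ k)"
          by (simp add: power2_eq_square power_one_over)
        also have "2 ^ k * 2 ^ k * (1 / 8) ^ k = (1 / 2 :: real) ^ k"
          by (simp flip: power_mult_distrib)
        finally show ?thesis .
      qed
      ultimately show ?thesis using B(2)[of k] by simp
    qed
    then show "\<exists>N. \<forall>k\<ge>N. norm (prob (B k)) \<le> ?f k" by blast
  qed
  then have "AE z in \<mu>. \<forall>\<^sub>F k in sequentially. z \<in> space \<mu> - B k"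
    by (intro borel_cantelli_AE1 B(1)) (auto simp: emeasure_eq_measure)
  then show ?thesis
  proof eventually_elim
    case (elim z)
    then show ?case by eventually_elim (rule B(3))
  qed
qed

end

section \<open>Passage to the limit law\<close>

lemma one_minus_power_tendsto_exp:
  fixes p :: "nat \<Rightarrow> real"
  assumes p: "\<And>n. 0 \<le> p n" "\<And>n. p n \<le> 1" and lim: "(\<lambda>n. real n * p n) \<longlonglongrightarrow> \<tau>"
    and p0: "p \<longlonglongrightarrow> 0"
  shows "(\<lambda>n. (1 - p n) ^ n) \<longlonglongrightarrow> exp (- \<tau>)"
proof -
  \<comment> \<open>For numbers in \<open>{0..1}\<close> the \<open>n\<close>-th powers differ by at
    most \<open>n\<close> times the difference of the bases, and \<open>exp (- p n)\<close> exceeds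
    \<open>1 - p n\<close> by at most \<open>p n * p n\<close>.\<close>
  have bound: "\<bar>(1 - p n) ^ n - exp (- (real n * p n))\<bar> \<le> real n * p n * p n" for n
  proof -
    have "1 / exp (p n) \<le> 1 / (1 + p n)"
      using p(1)[of n] by (intro divide_left_mono mult_pos_pos add_pos_nonneg) auto
    also have "\<dots> \<le> 1 - p n + p n * p n"
    proof -
      have "(1 - p n + p n * p n) * (1 + p n) = 1 + p n * p n * p n" by (simp add: algebra_simps)
      then have "1 \<le> (1 - p n + p n * p n) * (1 + p n)" using p(1)[of n] by simp
      then show ?thesis using p(1)[of n] by (simp add: divide_le_eq)
    qed
    finally have "exp (- p n) \<le> 1 - p n + p n * p n" by (simp add: exp_minus inverse_eq_divide)
    moreover have "1 - p n \<le> exp (- p n)" using exp_ge_add_one_self[of "- p n"] by simp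
    ultimately have "real n * \<bar>1 - p n - exp (- p n)\<bar> \<le> real n * (p n * p n)"
      by (intro mult_left_mono) auto
    moreover have "\<bar>(1 - p n) ^ n - exp (- p n) ^ n\<bar> \<le> real n * \<bar>1 - p n - exp (- p n)\<bar>"
      using norm_power_diff[of "1 - p n" "exp (- p n)" n] p[of n] by simp
    ultimately have "\<bar>(1 - p n) ^ n - exp (- p n) ^ n\<bar> \<le> real n * (p n * p n)" by linarith
    moreover have "exp (- p n) ^ n = exp (- (real n * p n))"
      using exp_of_nat_mult[of n "- p n"] by simp
    ultimately show ?thesis by (simp add: mult.assoc)
  qed
  have lim0: "(\<lambda>n. real n * p n * p n) \<longlonglongrightarrow> 0"
    using tendsto_mult[OF lim p0] by simp
  have "(\<lambda>n. (1 - p n) ^ n - exp (- (real n * p n))) \<longlonglongrightarrow> 0"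
    by (rule Lim_null_comparison[OF always_eventually lim0]) (simp add: bound)
  from tendsto_add[OF this tendsto_exp[OF tendsto_minus[OF lim]]] show ?thesis by simp
qed

lemma dyadic_scale:
  fixes r :: real
  assumes "0 < r" "r < 1"
  shows "\<exists>k. 1 / 2 ^ (k + 1) \<le> r \<and> r < 1 / 2 ^ k"
proof -
  define k where "k = (LEAST k. 1 / 2 ^ (k + 1) \<le> r)"
  obtain n where "(1 / 2) ^ n < r" using real_arch_pow_inv[of r "1 / 2"] assms by auto
  then have "1 / 2 ^ (n + 1) \<le> r" by (simp add: field_simps)
  then have k: "1 / 2 ^ (k + 1) \<le> r" unfolding k_def by (rule LeastI)
  have "r < 1 / 2 ^ k"
  proof (cases k)
    case (Suc j)
    then have "\<not> 1 / 2 ^ (j + 1) \<le> r" using not_less_Least[of j "\<lambda>k. 1 / 2 ^ (k + 1) \<le> r"] by (simp add: k_def)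
    then show ?thesis using Suc by simp
  qed (use assms in simp)
  then show ?thesis using k by blast
qed

text \<open>At \<open>x = z\<close> both sides are false, thanks to the value
  \<open>\<infinity>\<close> there, so the equivalence includes the centre of the ball.\<close>

lemma log_dist_obs_le_iff: "log_dist_obs z x \<le> ereal v \<longleftrightarrow> \<not> dist x z < exp (- v)"
proof (cases "x = z")
  case False
  then have "- ln (dist x z) \<le> v \<longleftrightarrow> exp (- v) \<le> dist x z"
    using ln_ge_iff[of "dist x z" "- v"] by auto
  then show ?thesis using False by (simp add: log_dist_obs_def not_less)
qed (simp add: log_dist_obs_def)

context baker_srb
begin

lemma max_process_le_eq_avoiding:
  assumes "0 < n"
  shows "{x \<in> unit_square. max_process T (log_dist_obs z) n x \<le> ereal v}
       = avoiding \<mu> T (square_ball z (exp (- v))) n"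
proof -
  have "max_process T (log_dist_obs z) n x \<le> ereal v \<longleftrightarrow> (\<forall>j<n. \<not> dist ((T ^^ j) x) z < exp (- v))" for x
    unfolding max_process_def using assms
    by (subst Max_le_iff) (auto simp: log_dist_obs_le_iff)
  then show ?thesis
    using funpow_space by (auto simp: avoiding_def square_ball_def space_mu)
qed

text \<open>Mixing is used with \<open>m\<close> equal to the square of \<open>k\<close>. The lower
  bound \<open>low\<close> converts \<open>n\<close> into at most \<open>t * 8 ^ k\<close>, which
  accounts for \<open>64 ^ k\<close> in the mixing term; \<open>ret\<close> bounds the returns
  within the gap, and \<open>prob A \<le> 2 / 2 ^ k\<close> bounds the quadratic term.\<close>

lemma avoiding_ball_bound:
  assumes z: "z \<in> unit_square" and r: "1 / 2 ^ (k + 1) \<le> r" "r < 1 / 2 ^ k" and k: "1 \<le> k" and n: "1 \<le> n"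
    and low: "1 / 8 ^ k \<le> prob (square_ball z (1 / 2 ^ (k + 1)))"
    and ret: "prob (square_ball z (1 / 2 ^ k) \<inter> near_returns k) \<le> (3 / 4) ^ k * prob (square_ball z (1 / 2 ^ (k + 1)))"
  defines "A \<equiv> square_ball z r"
  defines "t \<equiv> real n * prob A"
  shows "\<bar>prob (avoiding \<mu> T A n) - (1 - prob A) ^ n\<bar> \<le>
    8 * t\<^sup>2 * (64 ^ k * sqrt (6 * (1 / 2 ^ k\<^sup>2))) + t * (2 * (real k)\<^sup>2 * (3 / 4) ^ k)
    + t * (4 * (real k)\<^sup>2 / 2 ^ k)"
proof -
  let ?p = "prob A" and ?s = "sqrt (6 * (1 / 2 ^ k\<^sup>2))"
  let ?g = "2 * k\<^sup>2"
  have r0: "0 \<le> r" "r \<le> 1"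
    using r order_trans[OF less_imp_le[OF r(2)], of 1] order_trans[OF _ r(1), of 0] by auto
  have A[measurable]: "A \<in> sets \<mu>" unfolding A_def by measurable
  \<comment> \<open>\<open>A\<close> is squeezed between the balls of radii
    \<open>1 / 2 ^ (k + 1)\<close> and \<open>1 / 2 ^ k\<close>, so \<open>low\<close> and
    \<open>ret\<close> become statements about \<open>prob A\<close>.\<close>
  have p_low: "prob (square_ball z (1 / 2 ^ (k + 1))) \<le> ?p"
    unfolding A_def using r by (intro finite_measure_mono sets_square_ball) (auto simp: square_ball_def)
  have "?p \<le> 2 * r" unfolding A_def by (rule prob_square_ball_le[OF r0(1)])
  then have p_up: "?p \<le> 2 / 2 ^ k" using r(2) by simp
  have "1 \<le> 8 ^ k * ?p" using order_trans[OF low p_low] by (simp add: field_simps)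
  then have "real n * 1 \<le> real n * (8 ^ k * ?p)" by (intro mult_left_mono) auto
  then have n_le: "real n \<le> t * 8 ^ k" by (simp add: t_def mult_ac)
  let ?\<eta> = "2 * (real n + 1) * (2 * ?s)"
  let ?S = "\<Sum>j=1..<?g. prob (A \<inter> {x \<in> space \<mu>. (T ^^ j) x \<in> A})"
  have "\<bar>prob (avoiding \<mu> T A n) - (1 - ?p) ^ n\<bar> \<le> real n * (?\<eta> + ?S + real ?g * ?p\<^sup>2)"
  proof (rule avoiding_approx[OF measurable_baker_mu baker_invariant A])
    show "1 \<le> ?g" using k by simp
    fix N assume N: "N \<le> n"
    have "2 * (real N + 1) * (2 * ?s) \<le> ?\<eta>"
      using N by (intro mult_right_mono mult_left_mono) auto
    then show "\<bar>prob (A \<inter> {x \<in> space \<mu>. (T ^^ ?g) x \<in> avoiding \<mu> T A N})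
        - ?p * prob (avoiding \<mu> T A N)\<bar> \<le> ?\<eta>"
      using avoid_ball_mixing[OF z r0, of "k\<^sup>2" N] unfolding A_def by linarith
  qed
  also have "\<dots> = real n * ?\<eta> + real n * ?S + real n * (real ?g * ?p\<^sup>2)"
    by (simp add: distrib_left)
  also have "real n * ?\<eta> \<le> 8 * t\<^sup>2 * (64 ^ k * ?s)"
  proof -
    have "real n * ?\<eta> \<le> real n * (2 * (2 * real n) * (2 * ?s))"
      using n by (intro mult_left_mono mult_right_mono) auto
    also have "\<dots> = 8 * (real n)\<^sup>2 * ?s" by (simp add: power2_eq_square)
    also have "\<dots> \<le> 8 * (t * 8 ^ k)\<^sup>2 * ?s"
      using n_le by (intro mult_right_mono mult_left_mono power_mono) auto
    also have "(t * 8 ^ k)\<^sup>2 = t\<^sup>2 * 64 ^ k"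
      by (simp add: power2_eq_square flip: power_mult_distrib)
    finally show ?thesis by (simp add: mult_ac)
  qed
  also have "real n * ?S \<le> t * (2 * (real k)\<^sup>2 * (3 / 4) ^ k)"
  proof -
    have "prob (A \<inter> {x \<in> space \<mu>. (T ^^ j) x \<in> A}) \<le> (3 / 4) ^ k * ?p" if "j \<in> {1..<?g}" for j
    proof -
      have "A \<inter> {x \<in> space \<mu>. (T ^^ j) x \<in> A} \<subseteq> square_ball z (1 / 2 ^ k) \<inter> near_returns k"
      proof
        fix p assume p: "p \<in> A \<inter> {x \<in> space \<mu>. (T ^^ j) x \<in> A}"
        then have "dist p z < 1 / 2 ^ k" "dist ((T ^^ j) p) z < 1 / 2 ^ k" "p \<in> unit_square"
          using r by (auto simp: A_def square_ball_def)
        moreover from this have "dist p ((T ^^ j) p) < 2 / 2 ^ k"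
          using dist_triangle2[of p "(T ^^ j) p" z] by simp
        ultimately show "p \<in> square_ball z (1 / 2 ^ k) \<inter> near_returns k"
          using that by (auto simp: square_ball_def near_returns_def space_mu)
      qed
      then have "prob (A \<inter> {x \<in> space \<mu>. (T ^^ j) x \<in> A}) \<le> prob (square_ball z (1 / 2 ^ k) \<inter> near_returns k)"
        by (intro finite_measure_mono) auto
      also have "\<dots> \<le> (3 / 4) ^ k * prob (square_ball z (1 / 2 ^ (k + 1)))" by (rule ret)
      also have "\<dots> \<le> (3 / 4) ^ k * ?p" using p_low by (intro mult_left_mono) auto
      finally show ?thesis .
    qed
    then have "?S \<le> (\<Sum>j=1..<?g. (3 / 4) ^ k * ?p)" by (rule sum_mono)
    also have "\<dots> \<le> real ?g * ((3 / 4) ^ k * ?p)"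
      unfolding sum_constant by (intro mult_right_mono of_nat_mono) auto
    finally have "real n * ?S \<le> real n * (real ?g * ((3 / 4) ^ k * ?p))"
      by (intro mult_left_mono) auto
    then show ?thesis by (simp add: t_def mult_ac)
  qed
  also have "real n * (real ?g * ?p\<^sup>2) \<le> t * (4 * (real k)\<^sup>2 / 2 ^ k)"
  proof -
    have "real n * (real ?g * ?p\<^sup>2) = t * (2 * (real k)\<^sup>2 * ?p)"
      by (simp add: t_def power2_eq_square)
    also have "\<dots> \<le> t * (2 * (real k)\<^sup>2 * (2 / 2 ^ k))"
      using p_up by (intro mult_left_mono) (auto simp: t_def)
    finally show ?thesis by simp
  qed
  finally show ?thesis by simp
qed

text \<open>The bound at scale \<open>k\<close> is useful as \<open>k\<close> grows, so the dyadic
  scale \<open>K n\<close> of \<open>r n\<close> has to tend to infinity. It does: the ball measures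
  tend to 0, whereas every ball of a fixed small dyadic radius about \<open>z\<close> has measure
  bounded below.\<close>

lemma avoiding_ball_tendsto:
  assumes z: "z \<in> unit_square"
    and good: "\<forall>\<^sub>F k in sequentially. 1 / 8 ^ k \<le> prob (square_ball z (1 / 2 ^ (k + 1))) \<and>
     prob (square_ball z (1 / 2 ^ k) \<inter> near_returns k) \<le> (3 / 4) ^ k * prob (square_ball z (1 / 2 ^ (k + 1)))"
    and r: "\<And>n. 0 < r n" and lim: "(\<lambda>n. real n * prob (square_ball z (r n))) \<longlonglongrightarrow> \<tau>"
  shows "(\<lambda>n. prob (avoiding \<mu> T (square_ball z (r n)) n)) \<longlonglongrightarrow> exp (- \<tau>)"
proof -
  define p where "p n = prob (square_ball z (r n))" for n
  define t where "t n = real n * p n" for n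
  have t_lim: "t \<longlonglongrightarrow> \<tau>" using lim by (simp add: t_def[abs_def] p_def)
  have "(\<lambda>n. t n * (1 / real n)) \<longlonglongrightarrow> \<tau> * 0"
    by (intro tendsto_mult t_lim lim_1_over_n)
  moreover have "\<forall>\<^sub>F n in sequentially. t n * (1 / real n) = p n"
    using eventually_gt_at_top[of 0] by eventually_elim (simp add: t_def)
  ultimately have p0: "p \<longlonglongrightarrow> 0" by (simp add: Lim_transform_eventually)
  \<comment> \<open>The choice is meaningful only if \<open>r n < 1\<close>, which holds for all
    large \<open>n\<close>.\<close>
  define K where "K n = (SOME k. 1 / 2 ^ (k + 1) \<le> r n \<and> r n < 1 / 2 ^ k)" for n
  have K: "1 / 2 ^ (K n + 1) \<le> r n" "r n < 1 / 2 ^ K n" if "r n < 1" for n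
    using someI_ex[OF dyadic_scale[OF r that]] by (auto simp: K_def)
  obtain k0 where k0: "\<And>k. k \<ge> k0 \<Longrightarrow> 1 / 8 ^ k \<le> prob (square_ball z (1 / 2 ^ (k + 1)))"
    "\<And>k. k \<ge> k0 \<Longrightarrow>
      prob (square_ball z (1 / 2 ^ k) \<inter> near_returns k) \<le> (3 / 4) ^ k * prob (square_ball z (1 / 2 ^ (k + 1)))"
    using good by (auto simp: eventually_sequentially)
  have r_small: "\<forall>\<^sub>F n in sequentially. r n < 1 / 2 ^ (k + 1)" if "k \<ge> k0" for k
  proof -
    have "\<forall>\<^sub>F n in sequentially. p n < 1 / 8 ^ k"
      using p0 by (rule order_tendstoD) simp
    then show ?thesis
    proof eventually_elim
      case (elim n)
      then have *: "p n < prob (square_ball z (1 / 2 ^ (k + 1)))" using k0(1)[OF that] by simp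
      show ?case
      proof (rule ccontr)
        assume "\<not> r n < 1 / 2 ^ (k + 1)"
        then have "prob (square_ball z (1 / 2 ^ (k + 1))) \<le> p n"
          unfolding p_def by (intro finite_measure_mono sets_square_ball) (auto simp: square_ball_def)
        then show False using * by simp
      qed
    qed
  qed
  have r_1: "\<forall>\<^sub>F n in sequentially. r n < 1"
    using r_small[OF order_refl] by (rule eventually_mono) (erule less_le_trans, simp only: divide_le_eq_1_pos zero_less_power zero_less_numeral one_le_power one_le_numeral)
  have K_top: "filterlim K at_top sequentially"
    unfolding filterlim_at_top
  proof
    fix C
    have "\<forall>\<^sub>F n in sequentially. r n < 1 / 2 ^ (max C k0 + 1)" by (rule r_small) simp
    then show "\<forall>\<^sub>F n in sequentially. C \<le> K n" using r_1
    proof eventually_elim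
      case (elim n)
      have "1 / 2 ^ (K n + 1) < (1 / 2 ^ (max C k0 + 1) :: real)" using K(1)[OF elim(2)] elim(1) by linarith
      then have "(2::real) ^ (max C k0 + 1) < 2 ^ (K n + 1)" by (simp add: field_simps)
      then show ?case by (auto dest: power_less_imp_less_exp[rotated])
    qed
  qed
  let ?a = "\<lambda>k. 64 ^ k * sqrt (6 * (1 / 2 ^ k\<^sup>2)) :: real"
  let ?b = "\<lambda>k. 2 * (real k)\<^sup>2 * (3 / 4) ^ k" and ?c = "\<lambda>k. 4 * (real k)\<^sup>2 / 2 ^ k"
  \<comment> \<open>The exponent under the square root is quadratic in \<open>k\<close>, which beats
    \<open>64 ^ k\<close>.\<close>
  have "?a \<longlonglongrightarrow> 0" by real_asymp
  then have aK: "(\<lambda>n. ?a (K n)) \<longlonglongrightarrow> 0" by (rule filterlim_compose[OF _ K_top])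
  have "?b \<longlonglongrightarrow> 0" by real_asymp
  then have bK: "(\<lambda>n. ?b (K n)) \<longlonglongrightarrow> 0" by (rule filterlim_compose[OF _ K_top])
  have "?c \<longlonglongrightarrow> 0" by real_asymp
  then have cK: "(\<lambda>n. ?c (K n)) \<longlonglongrightarrow> 0" by (rule filterlim_compose[OF _ K_top])
  have "(\<lambda>n. 8 * (t n)\<^sup>2 * ?a (K n) + t n * ?b (K n) + t n * ?c (K n)) \<longlonglongrightarrow> 8 * \<tau>\<^sup>2 * 0 + \<tau> * 0 + \<tau> * 0"
    by (intro tendsto_add tendsto_mult[OF tendsto_mult[OF tendsto_const tendsto_power[OF t_lim]]]
        tendsto_mult[OF t_lim] aK bK cK)
  then have "(\<lambda>n. 8 * (t n)\<^sup>2 * ?a (K n) + t n * ?b (K n) + t n * ?c (K n)) \<longlonglongrightarrow> 0"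
    by (simp only: mult_zero_right add_0_right)
  moreover have "\<forall>\<^sub>F n in sequentially. norm (prob (avoiding \<mu> T (square_ball z (r n)) n) - (1 - p n) ^ n)
      \<le> 8 * (t n)\<^sup>2 * ?a (K n) + t n * ?b (K n) + t n * ?c (K n)"
    using filterlim_at_top[THEN iffD1, OF K_top, rule_format, of "max 1 k0"] r_1 eventually_ge_at_top[of 1]
  proof eventually_elim
    case (elim n)
    show ?case
      using avoiding_ball_bound[OF z K[OF elim(2)] _ elim(3) k0] elim(1)
      by (simp add: t_def p_def)
  qed
  ultimately have "(\<lambda>n. prob (avoiding \<mu> T (square_ball z (r n)) n) - (1 - p n) ^ n) \<longlonglongrightarrow> 0"
    by (rule Lim_null_comparison[rotated])
  moreover have "(\<lambda>n. (1 - p n) ^ n) \<longlonglongrightarrow> exp (- \<tau>)"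
    by (rule one_minus_power_tendsto_exp[OF _ _ t_lim[unfolded t_def[abs_def]] p0]) (simp_all add: p_def)
  ultimately show ?thesis by (rule Lim_transform[rotated])
qed

end

theorem proposition6p1:
  fixes \<gamma> :: real and \<mu> :: "(real \<times> real) measure"
  assumes "0 < \<gamma>" and "\<gamma> < 1 / 2"
    and "is_SRB_measure \<gamma> \<mu>"
  shows "AE z in \<mu>. \<not> periodic_point (baker \<gamma>) z \<longrightarrow>
           (\<forall>(\<tau>::real) (u :: nat \<Rightarrow> real).
              \<tau> > 0 \<longrightarrow>
              (\<lambda>n. real n * measure \<mu> (square_ball z (exp (- u n)))) \<longlonglongrightarrow> \<tau> \<longrightarrow>
              (\<lambda>n. measure \<mu> {x \<in> unit_square.
                      max_process (baker \<gamma>) (log_dist_obs z) n x \<le> ereal (u n)})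
                \<longlonglongrightarrow> exp (- \<tau>))"
proof -
  interpret baker_srb \<gamma> \<mu> by unfold_locales (use assms in auto)
  \<comment> \<open>The condition on \<open>z\<close> involves dyadic radii only, so a single null
    set serves all \<open>\<tau>\<close> and \<open>u\<close>.\<close>
  show ?thesis using AE_rare_near_returns AE_space
  proof eventually_elim
    case (elim z)
    show ?case
    proof (intro impI allI, rule Lim_transform_eventually)
      fix \<tau> and u :: "nat \<Rightarrow> real"
      assume "(\<lambda>n. real n * prob (square_ball z (exp (- u n)))) \<longlonglongrightarrow> \<tau>"
      then show "(\<lambda>n. prob (avoiding \<mu> T (square_ball z (exp (- u n))) n)) \<longlonglongrightarrow> exp (- \<tau>)"
        using elim by (intro avoiding_ball_tendsto) (auto simp: space_mu)
      show "\<forall>\<^sub>F n in sequentially. prob (avoiding \<mu> T (square_ball z (exp (- u n))) n)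
          = prob {x \<in> unit_square. max_process T (log_dist_obs z) n x \<le> ereal (u n)}"
        \<comment> \<open>At \<open>n = 0\<close> the process is a \<open>Max\<close> over the empty
          set, so the two events are compared for positive \<open>n\<close> only.\<close>
        using eventually_gt_at_top[of 0] by eventually_elim (simp add: max_process_le_eq_avoiding)
    qed
  qed
qed

end
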